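(* Let $f\in L^p(\Omega)$ with $1<p<\frac{2Q}{Q+2}$. Then the solution $u$ found by approximation of $$X^*(A(x)Xu)=f\ \text{ in }\Omega,\qquad u=0\ \text{ on }\partial\Omega$$ belongs to $L^{p^{**}}(\Omega)$, with $p^{**}=\frac{pQ}{Q-2p}$, and there exists a constant $C$, only depending on $Q,\Omega,p$ and $\alpha$ (the family $X$ being fixed), such that $$\|u\|_{L^{p^{**}}(\Omega)}\le C\|f\|_{L^p(\Omega)} .$$
   Context: Setting. $N\ge2$, $\Omega\subset\mathbb R^N$ is open and bounded, and $X=\{X_1,\dots,X_m\}$ is a fixed family of locally Lipschitz vector fields on $\mathbb R^N$, $X_j=\sum_{k=1}^N c_{jk}\partial_{x_k}$; for $u\in C^1$, $Xu=(X_1u,\dots,X_mu)$ is the $X$-gradient. An absolutely continuous path $\gamma:[0,T]\to\mathbb R^N$ is $X$-subunit if $\dot\gamma(t)=\sum_{j}\theta_j(t)X_j(\gamma(t))$ with $\sum_j\theta_j^2(t)\le1$ for a.e. $t$. It is assumed that any two points of $\Omega$ are joined by an $X$-subunit path in $\Omega$; $d_X(x,y)$ is the infimum of all $T>0$ for which there is an $X$-subunit $\gamma:[0,T]\to\mathbb R^N$ with $\gamma(0)=x$, $\gamma(T)=y$; $B_r$ denotes a $d_X$-ball of radius $r$ and $B_{cr}$ the concentric ball of radius $cr$. Standing assumptions: (i) $|y-x|\to0$ implies $d_X(x,y)\to0$; (ii) $(\Omega,d_X,\mathcal L^N)$ is doubling: there is $Q>2$ with $0<\mathcal L^N(B_{2r})\le2^Q\mathcal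 L^N(B_r)$; (iii) there are $C_P,\nu>0$ such that $\frac1{|B_r|}\int_{B_r}|u-u_r|\,dx\le C_P\,r\,\frac1{|B_{\nu r}|}\int_{B_{\nu r}}|Xu|\,dx$ for every $d_X$-ball $B_r$ and $u\in C^1(\overline{B_{\nu r}})$, with $u_r=\frac1{|B_r|}\int_{B_r}u\,dx$. $W^{1,p}_0(\Omega,X)$ is the closure of $C^\infty_c(\Omega)$ under the norm $\|Xu\|_{L^p(\Omega)}$ (with $Xu$ the $L^p$-limit of the $X$-gradients of approximating functions). Known fact (Sobolev inequality): for $1\le p<Q$ there is a constant $\mathcal S_p$ with $\|u\|_{L^{p^*}(\Omega)}\le\mathcal S_p\|Xu\|_{L^p(\Omega)}$ for all $u\in W^{1,p}_0(\Omega,X)$, $p^*=\frac{pQ}{Q-p}$. $A:\Omega\to\mathbb R^{m\times m}$ is measurable with bounded entries (not necessarily symmetric) and there are $0<\alpha<\beta$ with $\alpha|\eta|^2\le A(x)\eta\cdot\eta\le\beta|\eta|^2$ for all $\eta\in\mathbb R^m$. $X^*$ is the formal adjoint: $\langle X^*F,v\rangle=\int_\Omega F\cdot Xv$. Weak solution. For $h\in L^{\frac{2Q}{Q+2}}(\Omega)$, the weak solution of $X^*(AXu)=h$ in $\Omega$, $u=0$ on $\partial\Omega$, is the unique (Lax–Milgram) $u\in W^{1,2}_0(\Omega,X)$ with $\int_\Omega A\,Xu\cdot Xv=\int_\Omega h\,v$ for all $v\in W^{1,2}_0(\Omega,X)$. Solution found by approximation. For $f\in L^1(\Omega)$ let $f_n=\max\{-n,\min\{f,n\}\}$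 and let $u_n$ be the weak solution with datum $f_n$. The solution found by approximation is the limit $u$ of (a subsequence of) $(u_n)_n$, weakly in $W^{1,q}_0(\Omega,X)$ for every $1<q<\frac Q{Q-1}$ and strongly in $L^s(\Omega)$ for every $1\le s<\frac Q{Q-2}$; it exists and is unique, and does not change if $(f_n)$ is replaced by any other sequence in $L^{\frac{2Q}{Q+2}}(\Omega)$ converging to $f$ in $L^1(\Omega)$. *)

theory Defs
  imports "HOL-Analysis.Analysis"
begin

section \<open>Smooth functions and Lebesgue spaces\<close>

text \<open>\<open>Ck_on k U f\<close>: \<open>f\<close> is of class \<open>C\<^sup>k\<close> on the open set \<open>U\<close>.\<close>

primrec Ck_on :: "nat \<Rightarrow> (real ^ 'n) set \<Rightarrow> (real ^ 'n \<Rightarrow> real) \<Rightarrow> bool" where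
  "Ck_on 0 U f \<longleftrightarrow> continuous_on U f"
| "Ck_on (Suc k) U f \<longleftrightarrow>
     (\<forall>x\<in>U. f differentiable (at x)) \<and>
     (\<forall>i. Ck_on k U (\<lambda>x. frechet_derivative f (at x) (axis i 1)))"

definition test_fun :: "(real ^ 'n) set \<Rightarrow> (real ^ 'n \<Rightarrow> real) \<Rightarrow> bool" where
  "test_fun \<Omega> \<phi> \<longleftrightarrow>
     (\<forall>k. Ck_on k UNIV \<phi>) \<and>
     compact (closure {x. \<phi> x \<noteq> 0}) \<and> closure {x. \<phi> x \<noteq> 0} \<subseteq> \<Omega>"

definition in_Lp :: "real \<Rightarrow> (real ^ 'n) set \<Rightarrow> (real ^ 'n \<Rightarrow> 'b::euclidean_space) \<Rightarrow> bool" where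
  "in_Lp p \<Omega> u \<longleftrightarrow>
     u \<in> borel_measurable (lebesgue_on \<Omega>) \<and>
     integrable (lebesgue_on \<Omega>) (\<lambda>x. norm (u x) powr p)"

definition Lp_norm :: "real \<Rightarrow> (real ^ 'n) set \<Rightarrow> (real ^ 'n \<Rightarrow> 'b::euclidean_space) \<Rightarrow> real" where
  "Lp_norm p \<Omega> u = (\<integral>x. norm (u x) powr p \<partial>lebesgue_on \<Omega>) powr (1 / p)"

definition Lp_tendsto ::
    "real \<Rightarrow> (real ^ 'n) set \<Rightarrow> (nat \<Rightarrow> real ^ 'n \<Rightarrow> 'b::euclidean_space) \<Rightarrow> (real ^ 'n \<Rightarrow> 'b) \<Rightarrow> bool" where
  "Lp_tendsto p \<Omega> v u \<longleftrightarrow>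
     (\<forall>n. in_Lp p \<Omega> (v n)) \<and> in_Lp p \<Omega> u \<and>
     (\<lambda>n. Lp_norm p \<Omega> (\<lambda>x. v n x - u x)) \<longlonglongrightarrow> 0"

section \<open>The vector fields and their control distance\<close>

text \<open>The field \<open>X\<^sub>j = (\<Sum>k. c\<^sub>j\<^sub>k \<partial>\<^sub>k)\<close> is represented by its coefficient vector:
  \<open>X j x $ k = c\<^sub>j\<^sub>k(x)\<close>.\<close>

definition locally_Lipschitz_fields :: "('m \<Rightarrow> real ^ 'n \<Rightarrow> real ^ 'n) \<Rightarrow> bool" where
  "locally_Lipschitz_fields X \<longleftrightarrow> (\<forall>j x. \<exists>r>0. \<exists>L. L-lipschitz_on (ball x r) (X j))"

definition Xgrad ::
    "('m \<Rightarrow> real ^ 'n \<Rightarrow> real ^ 'n) \<Rightarrow> (real ^ 'n \<Rightarrow> real) \<Rightarrow> real ^ 'n \<Rightarrow> real ^ 'm" where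
  "Xgrad X u x = (\<chi> j. frechet_derivative u (at x) (X j x))"

definition abs_continuous_on_interval :: "real \<Rightarrow> real \<Rightarrow> (real \<Rightarrow> 'a::real_normed_vector) \<Rightarrow> bool" where
  "abs_continuous_on_interval a b \<gamma> \<longleftrightarrow>
     (\<forall>\<epsilon>>0. \<exists>\<delta>>0. \<forall>(n::nat) s t.
        (\<forall>i<n. a \<le> s i \<and> s i \<le> t i \<and> t i \<le> b) \<longrightarrow>
        (\<forall>i<n. \<forall>k<n. i \<noteq> k \<longrightarrow> {s i<..<t i} \<inter> {s k<..<t k} = {}) \<longrightarrow>
        (\<Sum>i<n. t i - s i) < \<delta> \<longrightarrow> (\<Sum>i<n. norm (\<gamma> (t i) - \<gamma> (s i))) < \<epsilon>)"

definition subunit_path ::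
    "('m::finite \<Rightarrow> real ^ 'n \<Rightarrow> real ^ 'n) \<Rightarrow> real \<Rightarrow> (real \<Rightarrow> real ^ 'n) \<Rightarrow> bool" where
  "subunit_path X T \<gamma> \<longleftrightarrow>
     abs_continuous_on_interval 0 T \<gamma> \<and>
     (\<exists>\<theta>. AE t in lebesgue_on {0..T}.
        (\<gamma> has_vector_derivative (\<Sum>j\<in>UNIV. \<theta> j t *\<^sub>R X j (\<gamma> t))) (at t) \<and>
        (\<Sum>j\<in>UNIV. (\<theta> j t)\<^sup>2) \<le> 1)"

text \<open>The value is \<open>\<infinity>\<close> when no subunit path joins the two points.\<close>

definition X_dist :: "('m::finite \<Rightarrow> real ^ 'n \<Rightarrow> real ^ 'n) \<Rightarrow> real ^ 'n \<Rightarrow> real ^ 'n \<Rightarrow> ereal" where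
  "X_dist X x y = Inf {ereal T |T. T > 0 \<and> (\<exists>\<gamma>. subunit_path X T \<gamma> \<and> \<gamma> 0 = x \<and> \<gamma> T = y)}"

definition X_ball :: "('m::finite \<Rightarrow> real ^ 'n \<Rightarrow> real ^ 'n) \<Rightarrow> real ^ 'n \<Rightarrow> real \<Rightarrow> (real ^ 'n) set" where
  "X_ball X x r = {y. X_dist X x y < ereal r}"

definition X_connected :: "('m::finite \<Rightarrow> real ^ 'n \<Rightarrow> real ^ 'n) \<Rightarrow> (real ^ 'n) set \<Rightarrow> bool" where
  "X_connected X \<Omega> \<longleftrightarrow>
     (\<forall>x\<in>\<Omega>. \<forall>y\<in>\<Omega>. \<exists>T>0. \<exists>\<gamma>.
        subunit_path X T \<gamma> \<and> \<gamma> 0 = x \<and> \<gamma> T = y \<and> \<gamma> ` {0..T} \<subseteq> \<Omega>)"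

section \<open>The standing assumptions on the metric measure space\<close>

definition X_dist_continuous :: "('m::finite \<Rightarrow> real ^ 'n \<Rightarrow> real ^ 'n) \<Rightarrow> (real ^ 'n) set \<Rightarrow> bool" where
  "X_dist_continuous X \<Omega> \<longleftrightarrow> (\<forall>x\<in>\<Omega>. ((\<lambda>y. X_dist X x y) \<longlongrightarrow> 0) (at x within \<Omega>))"

text \<open>Measurability of the balls is implied, since \<open>emeasure\<close> vanishes on non-measurable sets.\<close>

definition X_doubling :: "real \<Rightarrow> ('m::finite \<Rightarrow> real ^ 'n \<Rightarrow> real ^ 'n) \<Rightarrow> (real ^ 'n) set \<Rightarrow> bool" where
  "X_doubling Q X \<Omega> \<longleftrightarrow>
     (\<forall>x\<in>\<Omega>. \<forall>r>0.
        0 < emeasure lebesgue (X_ball X x (2 * r)) \<and>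
        emeasure lebesgue (X_ball X x (2 * r)) \<le> ennreal (2 powr Q) * emeasure lebesgue (X_ball X x r))"

text \<open>\<open>C\<^sup>1\<close> on a closed ball means \<open>C\<^sup>1\<close> on some open neighbourhood of it.  Both sides are
  extended nonnegative integrals, so that a divergent integral does not count as \<open>0\<close>;
  integrability of \<open>u\<close> is what gives its mean a meaning.\<close>

definition X_Poincare :: "('m::finite \<Rightarrow> real ^ 'n \<Rightarrow> real ^ 'n) \<Rightarrow> (real ^ 'n) set \<Rightarrow> bool" where
  "X_Poincare X \<Omega> \<longleftrightarrow>
     (\<exists>C\<^sub>P>0. \<exists>\<nu>>0. \<forall>x\<in>\<Omega>. \<forall>r>0. \<forall>u U.
        open U \<longrightarrow> closure (X_ball X x (\<nu> * r)) \<subseteq> U \<longrightarrow> Ck_on 1 U u \<longrightarrow>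
        integrable (lebesgue_on (X_ball X x r)) u \<longrightarrow>
        (let B = X_ball X x r;
             B' = X_ball X x (\<nu> * r);
             u\<^sub>r = (\<integral>y. u y \<partial>lebesgue_on B) / measure lebesgue B
         in (\<integral>\<^sup>+y. ennreal \<bar>u y - u\<^sub>r\<bar> \<partial>lebesgue_on B) / emeasure lebesgue B
            \<le> ennreal (C\<^sub>P * r) *
               ((\<integral>\<^sup>+y. ennreal (norm (Xgrad X u y)) \<partial>lebesgue_on B') / emeasure lebesgue B')))"

section \<open>The spaces \<open>W\<^sub>0\<^sup>1\<^sup>,\<^sup>p(\<Omega>,X)\<close>\<close>

text \<open>\<open>W0_grad p \<Omega> X u G\<close>: \<open>u\<close> lies in the closure of the test functions and \<open>G\<close> is its
  \<open>X\<close>-gradient.  A sequence of test functions that is Cauchy for the norm \<open>\<parallel>X\<phi>\<parallel>\<^sub>p\<close> determines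
  a function \<open>u\<close> through its limit in \<open>L\<^sup>p(\<Omega>)\<close>, which exists by the Sobolev inequality.\<close>

definition W0_grad ::
    "real \<Rightarrow> (real ^ 'n) set \<Rightarrow> ('m::finite \<Rightarrow> real ^ 'n \<Rightarrow> real ^ 'n) \<Rightarrow>
     (real ^ 'n \<Rightarrow> real) \<Rightarrow> (real ^ 'n \<Rightarrow> real ^ 'm) \<Rightarrow> bool" where
  "W0_grad p \<Omega> X u G \<longleftrightarrow>
     (\<exists>\<phi>. (\<forall>n. test_fun \<Omega> (\<phi> n)) \<and>
          Lp_tendsto p \<Omega> \<phi> u \<and> Lp_tendsto p \<Omega> (\<lambda>n. Xgrad X (\<phi> n)) G)"

definition in_W0 ::
    "real \<Rightarrow> (real ^ 'n) set \<Rightarrow> ('m::finite \<Rightarrow> real ^ 'n \<Rightarrow> real ^ 'n) \<Rightarrow> (real ^ 'n \<Rightarrow> real) \<Rightarrow> bool" where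
  "in_W0 p \<Omega> X u \<longleftrightarrow> (\<exists>G. W0_grad p \<Omega> X u G)"

definition W0_functional ::
    "real \<Rightarrow> (real ^ 'n) set \<Rightarrow> ('m::finite \<Rightarrow> real ^ 'n \<Rightarrow> real ^ 'n) \<Rightarrow>
     ((real ^ 'n \<Rightarrow> real) \<Rightarrow> real) \<Rightarrow> bool" where
  "W0_functional p \<Omega> X l \<longleftrightarrow>
     (\<forall>v w. in_W0 p \<Omega> X v \<longrightarrow> in_W0 p \<Omega> X w \<longrightarrow> l (\<lambda>x. v x + w x) = l v + l w) \<and>
     (\<forall>c v. in_W0 p \<Omega> X v \<longrightarrow> l (\<lambda>x. c * v x) = c * l v) \<and>
     (\<exists>K. \<forall>v H. W0_grad p \<Omega> X v H \<longrightarrow> \<bar>l v\<bar> \<le> K * Lp_norm p \<Omega> H)"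

definition W0_weakly_tendsto ::
    "real \<Rightarrow> (real ^ 'n) set \<Rightarrow> ('m::finite \<Rightarrow> real ^ 'n \<Rightarrow> real ^ 'n) \<Rightarrow>
     (nat \<Rightarrow> real ^ 'n \<Rightarrow> real) \<Rightarrow> (real ^ 'n \<Rightarrow> real) \<Rightarrow> bool" where
  "W0_weakly_tendsto p \<Omega> X v u \<longleftrightarrow>
     (\<forall>n. in_W0 p \<Omega> X (v n)) \<and> in_W0 p \<Omega> X u \<and>
     (\<forall>l. W0_functional p \<Omega> X l \<longrightarrow> (\<lambda>n. l (v n)) \<longlonglongrightarrow> l u)"

definition X_Sobolev :: "real \<Rightarrow> ('m::finite \<Rightarrow> real ^ 'n \<Rightarrow> real ^ 'n) \<Rightarrow> (real ^ 'n) set \<Rightarrow> bool" where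
  "X_Sobolev Q X \<Omega> \<longleftrightarrow>
     (\<forall>p. 1 \<le> p \<and> p < Q \<longrightarrow>
        (\<exists>S. \<forall>u G. W0_grad p \<Omega> X u G \<longrightarrow>
           in_Lp (p * Q / (Q - p)) \<Omega> u \<and>
           Lp_norm (p * Q / (Q - p)) \<Omega> u \<le> S * Lp_norm p \<Omega> G))"

section \<open>The Dirichlet problem\<close>

definition elliptic_coeff ::
    "real \<Rightarrow> real \<Rightarrow> (real ^ 'n) set \<Rightarrow> (real ^ 'n \<Rightarrow> real ^ 'm ^ 'm) \<Rightarrow> bool" where
  "elliptic_coeff \<alpha> \<beta> \<Omega> A \<longleftrightarrow>
     A \<in> borel_measurable (lebesgue_on \<Omega>) \<and>
     (\<exists>M. AE x in lebesgue_on \<Omega>. \<forall>i j. \<bar>A x $ i $ j\<bar> \<le> M) \<and>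
     (AE x in lebesgue_on \<Omega>. \<forall>\<eta>.
        \<alpha> * (norm \<eta>)\<^sup>2 \<le> (A x *v \<eta>) \<bullet> \<eta> \<and> (A x *v \<eta>) \<bullet> \<eta> \<le> \<beta> * (norm \<eta>)\<^sup>2)"

definition weak_solution ::
    "(real ^ 'n) set \<Rightarrow> ('m::finite \<Rightarrow> real ^ 'n \<Rightarrow> real ^ 'n) \<Rightarrow> (real ^ 'n \<Rightarrow> real ^ 'm ^ 'm) \<Rightarrow>
     (real ^ 'n \<Rightarrow> real) \<Rightarrow> (real ^ 'n \<Rightarrow> real) \<Rightarrow> bool" where
  "weak_solution \<Omega> X A h u \<longleftrightarrow>
     (\<exists>G. W0_grad 2 \<Omega> X u G \<and>
        (\<forall>v H. W0_grad 2 \<Omega> X v H \<longrightarrow>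
           (\<integral>x. (A x *v G x) \<bullet> H x \<partial>lebesgue_on \<Omega>) = (\<integral>x. h x * v x \<partial>lebesgue_on \<Omega>)))"

definition truncation :: "nat \<Rightarrow> ('a \<Rightarrow> real) \<Rightarrow> 'a \<Rightarrow> real" where
  "truncation n f x = max (- real n) (min (f x) (real n))"

definition approx_solution ::
    "real \<Rightarrow> (real ^ 'n) set \<Rightarrow> ('m::finite \<Rightarrow> real ^ 'n \<Rightarrow> real ^ 'n) \<Rightarrow> (real ^ 'n \<Rightarrow> real ^ 'm ^ 'm) \<Rightarrow>
     (real ^ 'n \<Rightarrow> real) \<Rightarrow> (real ^ 'n \<Rightarrow> real) \<Rightarrow> bool" where
  "approx_solution Q \<Omega> X A f u \<longleftrightarrow>
     (\<exists>v \<sigma>. (\<forall>n. weak_solution \<Omega> X A (truncation n f) (v n)) \<and>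
        strict_mono (\<sigma> :: nat \<Rightarrow> nat) \<and>
        (\<forall>q. 1 < q \<and> q < Q / (Q - 1) \<longrightarrow> W0_weakly_tendsto q \<Omega> X (v \<circ> \<sigma>) u) \<and>
        (\<forall>s. 1 \<le> s \<and> s < Q / (Q - 2) \<longrightarrow> Lp_tendsto s \<Omega> (v \<circ> \<sigma>) u))"

end

theory Submission
  imports Defs
begin

text \<open>
  The estimate is first proved for weak solutions \<open>u\<close> with datum \<open>h \<in> L\<^sup>p\<close>, with a constant that depends
  only on \<open>Q\<close>, \<open>p\<close>, \<open>\<alpha>\<close> and the Sobolev constant of \<open>W\<^sub>0\<^sup>1\<^sup>,\<^sup>2\<close>, and then passes to the limit.

  Formally one tests the equation with \<open>sgn u * \<bar>u\<bar>\<^sup>2\<^sup>\<gamma>\<^sup>-\<^sup>1\<close>, where \<open>1/2 < \<gamma> < 1\<close>.  Ellipticity and the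
  inequality of Hoelder bound the weighted energy \<open>\<integral> \<bar>u\<bar>\<^sup>2\<^sup>\<gamma>\<^sup>-\<^sup>2 \<bar>Xu\<bar>\<^sup>2\<close> by the norm of \<open>h\<close> in \<open>L\<^sup>p\<close> times
  the norm of \<open>\<bar>u\<bar>\<^sup>2\<^sup>\<gamma>\<^sup>-\<^sup>1\<close> in \<open>L\<^sup>q\<close>, \<open>1/p + 1/q = 1\<close>.  Up to a constant this energy is
  \<open>\<integral> \<bar>X(\<bar>u\<bar>\<^sup>\<gamma>)\<bar>\<^sup>2\<close>, and the Sobolev inequality bounds it from below by \<open>(\<integral> \<bar>u\<bar>\<^sup>\<gamma>\<^sup>s)\<^sup>2\<^sup>/\<^sup>s\<close> with
  \<open>s = 2 Q / (Q - 2)\<close>.  If \<open>\<gamma>\<close> is chosen so that \<open>\<gamma> s = (2 \<gamma> - 1) q\<close>, both sides contain the same integral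
  of \<open>\<bar>u\<bar>\<^sup>r\<close>, with \<open>r = p Q / (Q - 2 p)\<close>; it is finite because \<open>r < s\<close>, and dividing by its power on the
  right leaves \<open>\<parallel>u\<parallel>\<^sub>r \<le> C \<parallel>h\<parallel>\<^sub>p\<close>.  The algebra of the exponents is \<open>exponent_relations\<close>.

  The formal test function is singular where \<open>u = 0\<close>.  It is replaced by \<open>\<Phi>(u)\<close> with \<open>\<Phi>\<close> a primitive of
  \<open>(2 \<gamma> - 1) (\<epsilon>\<^sup>2 + t\<^sup>2)\<^sup>\<gamma>\<^sup>-\<^sup>1\<close>: such a \<open>\<Phi>\<close> is smooth with bounded derivative and maps test functions to
  test functions, so the chain rule \<open>W0_grad_compose\<close> makes \<open>\<Phi>(u)\<close> admissible.  The bounds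
  \<open>soft_power_bounds\<close> are uniform enough for \<open>\<epsilon>\<close> to be sent to zero by the lemma of Fatou, which gives
  \<open>weak_solution_Lp_estimate\<close>.

  Truncation does not increase the \<open>L\<^sup>p\<close> norm of the datum, so the approximating solutions satisfy the
  estimate uniformly.  They converge in \<open>L\<^sup>1\<close>, hence almost everywhere along a subsequence, and the lemma
  of Fatou transfers the bound to the limit.
\<close>

section \<open>Closure properties of smooth functions\<close>

text \<open>The predicate \<^const>\<open>Ck_on\<close> unfolds with \<^const>\<open>frechet_derivative\<close>, which is awkward to compute
  with.  This form allows every closure property below to be proved by exhibiting a derivative and
  an induction on the order.\<close>

lemma Ck_on_Suc_has_derivative:
  assumes "\<And>x. (f has_derivative f' x) (at x)"
  shows "Ck_on (Suc k) UNIV f \<longleftrightarrow> (\<forall>i. Ck_on k UNIV (\<lambda>x. f' x (axis i 1)))"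
proof -
  have "frechet_derivative f (at x) = f' x" for x
    using frechet_derivative_at[OF assms[of x]] by simp
  then show ?thesis
    using assms by (auto simp: differentiable_def)
qed

lemma Ck_on_Suc_has_frechet_derivative:
  "Ck_on (Suc k) UNIV f \<Longrightarrow> (f has_derivative frechet_derivative f (at x)) (at x)"
  by (simp flip: frechet_derivative_works)

lemma Ck_on_SucD: "Ck_on (Suc k) UNIV f \<Longrightarrow> Ck_on k UNIV f"
proof (induction k arbitrary: f)
  case 0
  then show ?case
    by (auto intro!: continuous_at_imp_continuous_on differentiable_imp_continuous_within)
next
  case (Suc k)
  show ?case
    using Suc.prems Suc.IH unfolding Ck_on.simps(2)[of "Suc k"] Ck_on.simps(2)[of k] by blast
qed

lemma Ck_on_const: "Ck_on k UNIV (\<lambda>x. c)"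
proof (induction k arbitrary: c)
  case (Suc k)
  show ?case
    using Suc by (subst Ck_on_Suc_has_derivative[where f' = "\<lambda>x h. 0"]) auto
qed simp

lemma Ck_on_add:
  "Ck_on k UNIV f \<Longrightarrow> Ck_on k UNIV g \<Longrightarrow> Ck_on k UNIV (\<lambda>x. f x + g x)"
proof (induction k arbitrary: f g)
  case 0
  then show ?case by (auto intro: continuous_intros)
next
  case (Suc k)
  have "((\<lambda>x. f x + g x) has_derivative
      (\<lambda>h. frechet_derivative f (at x) h + frechet_derivative g (at x) h)) (at x)" for x
    using Suc.prems by (intro has_derivative_add Ck_on_Suc_has_frechet_derivative)
  then show ?case
    by (subst Ck_on_Suc_has_derivative) (use Suc in auto)
qed

lemma Ck_on_mult:
  "Ck_on k UNIV f \<Longrightarrow> Ck_on k UNIV g \<Longrightarrow> Ck_on k UNIV (\<lambda>x. f x * g x)"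
proof (induction k arbitrary: f g)
  case 0
  then show ?case by (auto intro: continuous_intros)
next
  case (Suc k)
  have "((\<lambda>x. f x * g x) has_derivative
      (\<lambda>h. f x * frechet_derivative g (at x) h + frechet_derivative f (at x) h * g x)) (at x)" for x
    using Suc.prems by (intro has_derivative_mult Ck_on_Suc_has_frechet_derivative)
  moreover have "Ck_on k UNIV f" "Ck_on k UNIV g"
    using Suc.prems by (blast intro: Ck_on_SucD)+
  ultimately show ?case
    by (subst Ck_on_Suc_has_derivative) (use Suc in \<open>auto intro!: Ck_on_add\<close>)
qed

text \<open>The outer function enters only through \<open>g \<circ> f\<close>, where \<open>g = \<Phi>'\<close>; hence no theory of \<open>C\<^sup>k\<close> functions
  of one variable is needed, and an antiderivative without a closed form is admissible as soon as
  its derivative is explicit.\<close>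

lemma Ck_on_compose_antiderivative:
  assumes "\<And>t. (\<Phi> has_real_derivative g t) (at t)"
    and "Ck_on k UNIV (\<lambda>x. g (f x))" and "Ck_on (Suc k) UNIV f"
  shows "Ck_on (Suc k) UNIV (\<lambda>x. \<Phi> (f x))"
proof -
  have "((\<lambda>x. \<Phi> (f x)) has_derivative
      (\<lambda>h. g (f x) * frechet_derivative f (at x) h)) (at x)" for x
    by (rule has_derivative_compose[OF Ck_on_Suc_has_frechet_derivative[OF assms(3)]
          has_field_derivative_imp_has_derivative[OF assms(1)]])
  then show ?thesis
    by (subst Ck_on_Suc_has_derivative) (use assms in \<open>auto intro!: Ck_on_mult\<close>)
qed

text \<open>The exponent has to be arbitrary in the induction, since each differentiation lowers it by one.\<close>

lemma Ck_on_powr: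
  assumes "\<And>x. f x > 0" and "Ck_on k UNIV f"
  shows "Ck_on k UNIV (\<lambda>x. f x powr b)"
  using assms(2)
proof (induction k arbitrary: b)
  case 0
  then show ?case using assms(1) by (auto intro!: continuous_intros simp: less_imp_neq less_imp_neq[symmetric])
next
  case (Suc k)
  have "((\<lambda>x. f x powr b) has_derivative
      (\<lambda>h. (b * f x powr (b - 1)) * frechet_derivative f (at x) h)) (at x)" for x
    by (rule has_derivative_compose[OF Ck_on_Suc_has_frechet_derivative[OF Suc.prems]
          has_field_derivative_imp_has_derivative[OF has_real_derivative_powr[OF assms(1)]]])
  moreover have "Ck_on k UNIV (\<lambda>x. f x powr (b - 1))"
    using Suc.IH Ck_on_SucD[OF Suc.prems] by blast
  ultimately show ?case
    by (subst Ck_on_Suc_has_derivative)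
       (use Suc.prems in \<open>auto intro!: Ck_on_mult Ck_on_const\<close>)
qed

lemma test_fun_compose:
  assumes "test_fun \<Omega> \<phi>" and "\<Phi> 0 = 0" and "\<And>k. Ck_on k UNIV (\<lambda>x. \<Phi> (\<phi> x))"
  shows "test_fun \<Omega> (\<lambda>x. \<Phi> (\<phi> x))"
proof -
  have "closure {x. \<Phi> (\<phi> x) \<noteq> 0} \<subseteq> closure {x. \<phi> x \<noteq> 0}"
    using assms(2) by (intro closure_mono) auto
  then show ?thesis
    using assms unfolding test_fun_def
    by (meson closed_closure compact_closure closed_Int_compact compact_eq_bounded_closed
        bounded_subset subset_trans)
qed

lemma Xgrad_compose:
  assumes "(\<Phi> has_real_derivative c) (at (\<phi> x))" and "\<phi> differentiable (at x)"
  shows "Xgrad X (\<lambda>x. \<Phi> (\<phi> x)) x = c *\<^sub>R Xgrad X \<phi> x"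
proof -
  have "((\<lambda>x. \<Phi> (\<phi> x)) has_derivative (\<lambda>h. c * frechet_derivative \<phi> (at x) h)) (at x)"
    by (rule has_derivative_compose[OF assms(2)[unfolded frechet_derivative_works]
          has_field_derivative_imp_has_derivative[OF assms(1)]])
  from frechet_derivative_at[OF this]
  have "frechet_derivative (\<lambda>x. \<Phi> (\<phi> x)) (at x) = (\<lambda>h. c * frechet_derivative \<phi> (at x) h)"
    by simp
  then show ?thesis
    by (simp add: Xgrad_def vec_eq_iff)
qed

section \<open>Regularised powers\<close>

text \<open>A smooth odd substitute for \<open>sgn t * \<bar>t\<bar>\<^sup>a\<close> with \<open>0 < a < 1\<close>, whose derivative \<open>a * \<bar>t\<bar>\<^sup>a\<^sup>-\<^sup>1\<close> is
  singular at the origin: in it \<open>\<bar>t\<bar>\<close> is replaced by the square root of \<open>\<epsilon>\<^sup>2 + t\<^sup>2\<close>.  This makes the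
  derivative smooth and bounded.  The regularisation \<open>\<epsilon> + \<bar>t\<bar>\<close> would have explicit primitives, but
  these are only \<open>C\<^sup>1\<close>, so that composing them with test functions would not give test functions.\<close>

lemma soft_power_primitive:
  fixes \<epsilon> a :: real
  assumes "\<epsilon> > 0"
  obtains \<Phi> where "\<Phi> 0 = 0"
    "\<And>t. (\<Phi> has_real_derivative a * (\<epsilon>\<^sup>2 + t\<^sup>2) powr ((a - 1) / 2)) (at t)"
proof -
  let ?g = "\<lambda>t::real. a * (\<epsilon>\<^sup>2 + t\<^sup>2) powr ((a - 1) / 2)"
  have pos: "\<epsilon>\<^sup>2 + t\<^sup>2 > 0" for t :: real
    using assms by (simp add: add_pos_nonneg)
  have "isCont ?g t" for t
    using pos[of t] by (intro continuous_intros) auto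
  then have "\<exists>F. \<forall>t. (-\<infinity>::ereal) < ereal t \<longrightarrow> ereal t < \<infinity> \<longrightarrow> (F has_vector_derivative ?g t) (at t)"
    by (intro einterval_antiderivative) auto
  then obtain F where F: "\<And>t. (F has_real_derivative ?g t) (at t)"
    by (auto simp: has_real_derivative_iff_has_vector_derivative)
  show thesis
    by (rule that[of "\<lambda>t. F t - F 0"]) (auto intro!: derivative_eq_intros F)
qed

text \<open>The comparisons with powers follow from those of the derivatives: \<open>s\<^sup>2 \<le> \<epsilon>\<^sup>2 + s\<^sup>2 \<le> (\<epsilon> + s)\<^sup>2\<close>, and the exponent
  \<open>(a - 1) / 2\<close> is negative.\<close>

lemma soft_power_bounds_nonneg:
  fixes \<epsilon> a t :: real
  assumes "\<epsilon> > 0" "0 < a" "a < 1" "t \<ge> 0" and "\<Phi> 0 = 0"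
    and D: "\<And>t. (\<Phi> has_real_derivative a * (\<epsilon>\<^sup>2 + t\<^sup>2) powr ((a - 1) / 2)) (at t)"
  shows "0 \<le> \<Phi> t" and "(\<epsilon> + t) powr a - \<epsilon> powr a \<le> \<Phi> t" and "\<Phi> t \<le> t powr a"
proof -
  have sqrt_powr: "(s\<^sup>2) powr ((a - 1) / 2) = s powr (a - 1)" if "s > 0" for s :: real
    using that powr_powr[of s 2 "(a - 1) / 2"] by (simp add: diff_divide_distrib)
  have cont: "continuous_on {0..t} \<Phi>"
    using D by (blast intro: DERIV_continuous continuous_at_imp_continuous_on)
  have "\<Phi> 0 \<le> \<Phi> t"
    using D assms(2) by (intro DERIV_nonneg_imp_nondecreasing[OF \<open>t \<ge> 0\<close>]) (metis mult_nonneg_nonneg powr_ge_zero less_imp_le)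
  then show "0 \<le> \<Phi> t" using \<open>\<Phi> 0 = 0\<close> by simp
  have "\<Phi> 0 - (\<epsilon> + 0) powr a \<le> \<Phi> t - (\<epsilon> + t) powr a"
  proof (rule DERIV_nonneg_imp_nondecreasing[OF \<open>t \<ge> 0\<close>])
    fix s assume s: "0 \<le> s" "s \<le> t"
    have "(\<epsilon> + s) powr (a - 1) = ((\<epsilon> + s)\<^sup>2) powr ((a - 1) / 2)"
      using s assms by (simp add: sqrt_powr)
    also have "\<dots> \<le> (\<epsilon>\<^sup>2 + s\<^sup>2) powr ((a - 1) / 2)"
      using s assms by (intro powr_mono2') (auto simp: power2_sum add_pos_nonneg)
    finally have "a * (\<epsilon> + s) powr (a - 1) \<le> a * (\<epsilon>\<^sup>2 + s\<^sup>2) powr ((a - 1) / 2)"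
      using assms by simp
    moreover have "((\<lambda>s. \<Phi> s - (\<epsilon> + s) powr a) has_real_derivative
        a * (\<epsilon>\<^sup>2 + s\<^sup>2) powr ((a - 1) / 2) - a * (\<epsilon> + s) powr (a - 1)) (at s)"
      using s assms by (auto intro!: derivative_eq_intros D)
    ultimately show "\<exists>y. ((\<lambda>s. \<Phi> s - (\<epsilon> + s) powr a) has_real_derivative y) (at s) \<and> 0 \<le> y"
      by (intro exI[of _ "a * (\<epsilon>\<^sup>2 + s\<^sup>2) powr ((a - 1) / 2) - a * (\<epsilon> + s) powr (a - 1)"]) simp
  qed
  then show "(\<epsilon> + t) powr a - \<epsilon> powr a \<le> \<Phi> t"
    using \<open>\<Phi> 0 = 0\<close> by simp
  have "0 powr a - \<Phi> 0 \<le> t powr a - \<Phi> t"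
  proof (rule DERIV_nonneg_imp_increasing_open[OF \<open>t \<ge> 0\<close>])
    fix s assume s: "0 < s" "s < t"
    have "(\<epsilon>\<^sup>2 + s\<^sup>2) powr ((a - 1) / 2) \<le> (s\<^sup>2) powr ((a - 1) / 2)"
      using s assms by (intro powr_mono2') auto
    then have "a * (\<epsilon>\<^sup>2 + s\<^sup>2) powr ((a - 1) / 2) \<le> a * s powr (a - 1)"
      using assms s by (simp add: sqrt_powr)
    moreover have "((\<lambda>s. s powr a - \<Phi> s) has_real_derivative
        a * s powr (a - 1) - a * (\<epsilon>\<^sup>2 + s\<^sup>2) powr ((a - 1) / 2)) (at s)"
      using s assms by (auto intro!: derivative_eq_intros D)
    ultimately show "\<exists>y. ((\<lambda>s. s powr a - \<Phi> s) has_real_derivative y) (at s) \<and> 0 \<le> y"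
      by (intro exI[of _ "a * s powr (a - 1) - a * (\<epsilon>\<^sup>2 + s\<^sup>2) powr ((a - 1) / 2)"]) simp
  next
    show "continuous_on {0..t} (\<lambda>s. s powr a - \<Phi> s)"
      using assms cont by (intro continuous_on_diff continuous_on_powr') (auto intro: continuous_intros)
  qed
  then show "\<Phi> t \<le> t powr a"
    using \<open>\<Phi> 0 = 0\<close> by simp
qed

text \<open>For negative arguments \<open>t \<mapsto> - \<Phi> (- t)\<close> is a primitive of the same even function.\<close>

lemma soft_power_bounds:
  fixes \<epsilon> a t :: real
  assumes "\<epsilon> > 0" "0 < a" "a < 1" and "\<Phi> 0 = 0"
    and D: "\<And>t. (\<Phi> has_real_derivative a * (\<epsilon>\<^sup>2 + t\<^sup>2) powr ((a - 1) / 2)) (at t)"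
  shows "(\<epsilon> + \<bar>t\<bar>) powr a - \<epsilon> powr a \<le> \<bar>\<Phi> t\<bar>" and "\<bar>\<Phi> t\<bar> \<le> \<bar>t\<bar> powr a"
proof -
  note pos = soft_power_bounds_nonneg[OF assms(1-3) _ assms(4) D]
  have "((\<lambda>t. - \<Phi> (- t)) has_real_derivative a * (\<epsilon>\<^sup>2 + t\<^sup>2) powr ((a - 1) / 2)) (at t)" for t
    using DERIV_minus[OF D[of "- t", unfolded DERIV_mirror]] by simp
  note neg = soft_power_bounds_nonneg[OF assms(1-3), of _ "\<lambda>t. - \<Phi> (- t)", OF _ _ this]
  show "(\<epsilon> + \<bar>t\<bar>) powr a - \<epsilon> powr a \<le> \<bar>\<Phi> t\<bar>" "\<bar>\<Phi> t\<bar> \<le> \<bar>t\<bar> powr a"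
    using pos[of t] neg[of "- t"] assms(4) by (cases "t \<ge> 0"; auto)+
qed

text \<open>The derivative of \<open>\<Phi>\<close> at \<open>f x\<close> is a power of the positive smooth function \<open>\<epsilon>\<^sup>2 + (f x)\<^sup>2\<close>.\<close>

lemma Ck_on_soft_power:
  fixes \<epsilon> a :: real
  assumes "\<epsilon> > 0"
    and D: "\<And>t. (\<Phi> has_real_derivative a * (\<epsilon>\<^sup>2 + t\<^sup>2) powr ((a - 1) / 2)) (at t)"
    and f: "\<And>k. Ck_on k UNIV f"
  shows "Ck_on k UNIV (\<lambda>x. \<Phi> (f x))"
proof -
  have pos: "\<epsilon>\<^sup>2 + t\<^sup>2 > 0" for t :: real
    using assms by (simp add: add_pos_nonneg)
  have "Ck_on k UNIV (\<lambda>x. a * (\<epsilon>\<^sup>2 + f x * f x) powr ((a - 1) / 2))"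
    using pos by (intro Ck_on_mult Ck_on_const Ck_on_powr Ck_on_add f) (simp add: power2_eq_square)
  then have "Ck_on (Suc k) UNIV (\<lambda>x. \<Phi> (f x))"
    by (intro Ck_on_compose_antiderivative[OF D] f) (simp add: power2_eq_square)
  then show ?thesis
    by (rule Ck_on_SucD)
qed

section \<open>Convergence and inequalities in Lebesgue spaces\<close>

text \<open>A substitute for Minkowski's inequality that is valid for all \<open>p > 0\<close>: it suffices for
  integrability and for convergence, where constants do not matter.\<close>

lemma norm_add_powr_le:
  fixes a b :: "'a::real_normed_vector"
  assumes "p > 0"
  shows "norm (a + b) powr p \<le> 2 powr p * (norm a powr p + norm b powr p)"
proof -
  have "norm (a + b) powr p \<le> (2 * max (norm a) (norm b)) powr p"
    using assms norm_triangle_ineq[of a b] by (intro powr_mono2) auto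
  also have "\<dots> = 2 powr p * max (norm a) (norm b) powr p"
    by (simp add: powr_mult)
  also have "\<dots> \<le> 2 powr p * (norm a powr p + norm b powr p)"
    by (auto simp: max_def)
  finally show ?thesis .
qed

lemma in_Lp_bounded:
  assumes "p > 0" "in_Lp p \<Omega> f" "g \<in> borel_measurable (lebesgue_on \<Omega>)"
    and "\<And>x. norm (g x) \<le> c * norm (f x)"
  shows "in_Lp p \<Omega> g"
proof -
  have [measurable]: "g \<in> borel_measurable (lebesgue_on \<Omega>)" by fact
  have "norm (g x) powr p \<le> \<bar>c\<bar> powr p * norm (f x) powr p" for x
  proof -
    have "norm (g x) \<le> \<bar>c\<bar> * norm (f x)"
      by (rule order_trans[OF assms(4) mult_right_mono[OF abs_ge_self norm_ge_zero]])
    then have "norm (g x) powr p \<le> (\<bar>c\<bar> * norm (f x)) powr p"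
      using assms(1) by (intro powr_mono2) auto
    then show ?thesis by (simp add: powr_mult)
  qed
  note bound = this
  have "integrable (lebesgue_on \<Omega>) (\<lambda>x. norm (g x) powr p)"
  proof (rule Bochner_Integration.integrable_bound)
    show "integrable (lebesgue_on \<Omega>) (\<lambda>x. \<bar>c\<bar> powr p * norm (f x) powr p)"
      using assms(2) by (simp add: in_Lp_def)
    show "AE x in lebesgue_on \<Omega>. norm (norm (g x) powr p) \<le> norm (\<bar>c\<bar> powr p * norm (f x) powr p)"
      by (rule AE_I2) (simp add: bound abs_mult)
  qed measurable
  then show ?thesis
    using assms by (simp add: in_Lp_def)
qed

lemma in_Lp_add:
  assumes "p > 0" "in_Lp p \<Omega> f" "in_Lp p \<Omega> g"
  shows "in_Lp p \<Omega> (\<lambda>x. f x + g x)"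
proof -
  have [measurable]: "f \<in> borel_measurable (lebesgue_on \<Omega>)" "g \<in> borel_measurable (lebesgue_on \<Omega>)"
    using assms by (auto simp: in_Lp_def)
  have "integrable (lebesgue_on \<Omega>) (\<lambda>x. norm (f x + g x) powr p)"
  proof (rule Bochner_Integration.integrable_bound)
    show "integrable (lebesgue_on \<Omega>) (\<lambda>x. 2 powr p * (norm (f x) powr p + norm (g x) powr p))"
      using assms by (simp add: in_Lp_def)
    show "AE x in lebesgue_on \<Omega>. norm (norm (f x + g x) powr p)
        \<le> norm (2 powr p * (norm (f x) powr p + norm (g x) powr p))"
      by (rule AE_I2) (simp add: norm_add_powr_le[OF assms(1)] abs_mult)
  qed measurable
  then show ?thesis
    by (simp add: in_Lp_def)
qed

lemma in_Lp_diff: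
  assumes "p > 0" "in_Lp p \<Omega> f" "in_Lp p \<Omega> g"
  shows "in_Lp p \<Omega> (\<lambda>x. f x - g x)"
proof -
  have "in_Lp p \<Omega> (\<lambda>x. - g x)"
    using assms(3) by (simp add: in_Lp_def)
  from in_Lp_add[OF assms(1,2) this] show ?thesis by simp
qed

lemma Lp_norm_powr: "p > 0 \<Longrightarrow> Lp_norm p \<Omega> f powr p = (\<integral>x. norm (f x) powr p \<partial>lebesgue_on \<Omega>)"
  by (simp add: Lp_norm_def powr_powr)

lemma Lp_norm_tendsto_0_iff:
  assumes "p > 0"
  shows "(\<lambda>n. Lp_norm p \<Omega> (w n)) \<longlonglongrightarrow> 0 \<longleftrightarrow>
    (\<lambda>n. \<integral>x. norm (w n x) powr p \<partial>lebesgue_on \<Omega>) \<longlonglongrightarrow> 0"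
proof
  assume "(\<lambda>n. Lp_norm p \<Omega> (w n)) \<longlonglongrightarrow> 0"
  from tendsto_zero_powrI[OF this tendsto_const _ assms]
  show "(\<lambda>n. \<integral>x. norm (w n x) powr p \<partial>lebesgue_on \<Omega>) \<longlonglongrightarrow> 0"
    by (simp add: Lp_norm_powr assms) (simp add: Lp_norm_def)
next
  assume "(\<lambda>n. \<integral>x. norm (w n x) powr p \<partial>lebesgue_on \<Omega>) \<longlonglongrightarrow> 0"
  then show "(\<lambda>n. Lp_norm p \<Omega> (w n)) \<longlonglongrightarrow> 0"
    unfolding Lp_norm_def using assms by (intro tendsto_zero_powrI[OF _ tendsto_const]) auto
qed

lemma Lp_tendsto_iff:
  assumes "p > 0"
  shows "Lp_tendsto p \<Omega> v u \<longleftrightarrow> (\<forall>n. in_Lp p \<Omega> (v n)) \<and> in_Lp p \<Omega> u \<and>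
    (\<lambda>n. \<integral>x. norm (v n x - u x) powr p \<partial>lebesgue_on \<Omega>) \<longlonglongrightarrow> 0"
  by (simp add: Lp_tendsto_def Lp_norm_tendsto_0_iff[OF assms])

lemma Lp_tendsto_subseq:
  "Lp_tendsto p \<Omega> v u \<Longrightarrow> strict_mono r \<Longrightarrow> Lp_tendsto p \<Omega> (\<lambda>n. v (r n)) u"
  unfolding Lp_tendsto_def
  using LIMSEQ_subseq_LIMSEQ[of "\<lambda>n. Lp_norm p \<Omega> (\<lambda>x. v n x - u x)" 0 r] by (auto simp: o_def)

text \<open>The \<open>p\<close>-th powers of the differences tend to zero in \<open>L\<^sup>1\<close>.\<close>

lemma Lp_tendsto_AE_subseq:
  assumes "p > 0" "Lp_tendsto p \<Omega> v u"
  obtains r :: "nat \<Rightarrow> nat" where "strict_mono r"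
    "AE x in lebesgue_on \<Omega>. (\<lambda>n. v (r n) x) \<longlonglongrightarrow> u x"
proof -
  have v: "\<And>n. in_Lp p \<Omega> (\<lambda>x. v n x - u x)"
    using assms by (auto simp: Lp_tendsto_def intro: in_Lp_diff)
  obtain r :: "nat \<Rightarrow> nat" where "strict_mono r"
    and r: "AE x in lebesgue_on \<Omega>. (\<lambda>n. norm (v (r n) x - u x) powr p) \<longlonglongrightarrow> 0"
    using tendsto_L1_AE_subseq[of "lebesgue_on \<Omega>" "\<lambda>n x. norm (v n x - u x) powr p"] v
      assms(2)[unfolded Lp_tendsto_iff[OF assms(1)]]
    by (auto simp: in_Lp_def)
  from r have "AE x in lebesgue_on \<Omega>. (\<lambda>n. v (r n) x) \<longlonglongrightarrow> u x"
  proof eventually_elim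
    case (elim x)
    from tendsto_zero_powrI[OF elim tendsto_const, of "1 / p"] assms(1)
    have "(\<lambda>n. norm (v (r n) x - u x)) \<longlonglongrightarrow> 0"
      by (simp add: powr_powr)
    then show ?case
      by (simp add: LIM_zero_iff tendsto_norm_zero_iff)
  qed
  with \<open>strict_mono r\<close> show thesis by (rule that)
qed

lemma Lp_tendsto_compare:
  assumes "p > 0" "Lp_tendsto p \<Omega> v u" "\<And>n. in_Lp p \<Omega> (w n)" "in_Lp p \<Omega> z"
    and "\<And>n x. norm (w n x - z x) \<le> c * norm (v n x - u x)"
  shows "Lp_tendsto p \<Omega> w z"
proof -
  have vu: "in_Lp p \<Omega> (\<lambda>x. v n x - u x)" and wz: "in_Lp p \<Omega> (\<lambda>x. w n x - z x)" for n
    using assms(1-4) unfolding Lp_tendsto_def by (blast intro: in_Lp_diff)+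
  have le: "norm (w n x - z x) powr p \<le> \<bar>c\<bar> powr p * norm (v n x - u x) powr p" for n x
  proof -
    have "norm (w n x - z x) \<le> \<bar>c\<bar> * norm (v n x - u x)"
      by (rule order_trans[OF assms(5) mult_right_mono[OF abs_ge_self norm_ge_zero]])
    then have "norm (w n x - z x) powr p \<le> (\<bar>c\<bar> * norm (v n x - u x)) powr p"
      using assms(1) by (intro powr_mono2) auto
    then show ?thesis by (simp add: powr_mult)
  qed
  have "(\<lambda>n. \<bar>c\<bar> powr p * (\<integral>x. norm (v n x - u x) powr p \<partial>lebesgue_on \<Omega>)) \<longlonglongrightarrow> 0"
    using assms(2)[unfolded Lp_tendsto_iff[OF assms(1)]] by (intro tendsto_mult_right_zero) blast
  note lim = this
  have le_I: "(\<integral>x. norm (w n x - z x) powr p \<partial>lebesgue_on \<Omega>)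
      \<le> \<bar>c\<bar> powr p * (\<integral>x. norm (v n x - u x) powr p \<partial>lebesgue_on \<Omega>)" for n
  proof -
    have "(\<integral>x. norm (w n x - z x) powr p \<partial>lebesgue_on \<Omega>)
        \<le> (\<integral>x. \<bar>c\<bar> powr p * norm (v n x - u x) powr p \<partial>lebesgue_on \<Omega>)"
      using vu[of n] wz[of n] by (intro integral_mono le) (simp_all add: in_Lp_def)
    then show ?thesis by simp
  qed
  have "(\<lambda>n. \<integral>x. norm (w n x - z x) powr p \<partial>lebesgue_on \<Omega>) \<longlonglongrightarrow> 0"
    by (rule tendsto_sandwich[OF always_eventually always_eventually tendsto_const lim])
       (simp, use le_I in blast)
  with assms(3,4) show ?thesis by (simp add: Lp_tendsto_iff[OF assms(1)])
qed

lemma Lp_tendsto_add: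
  assumes "p > 0" "Lp_tendsto p \<Omega> v u" "Lp_tendsto p \<Omega> w z"
  shows "Lp_tendsto p \<Omega> (\<lambda>n x. v n x + w n x) (\<lambda>x. u x + z x)"
proof -
  let ?I = "\<lambda>v u n. \<integral>x. norm (v n x - u x) powr p \<partial>lebesgue_on \<Omega>"
  have Lp: "in_Lp p \<Omega> u" "in_Lp p \<Omega> z" "in_Lp p \<Omega> (v n)" "in_Lp p \<Omega> (w n)" for n
    using assms by (auto simp: Lp_tendsto_def)
  have d: "in_Lp p \<Omega> (\<lambda>x. v n x - u x)" "in_Lp p \<Omega> (\<lambda>x. w n x - z x)"
    "in_Lp p \<Omega> (\<lambda>x. (v n x + w n x) - (u x + z x))" for n
    by (intro in_Lp_diff in_Lp_add assms(1) Lp)+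
  have "norm ((v n x + w n x) - (u x + z x)) powr p
      \<le> 2 powr p * (norm (v n x - u x) powr p + norm (w n x - z x) powr p)" for n x
    using norm_add_powr_le[OF assms(1), of "v n x - u x" "w n x - z x"] by (simp add: algebra_simps)
  note le = this
  have "?I (\<lambda>n x. v n x + w n x) (\<lambda>x. u x + z x) n \<le> 2 powr p * (?I v u n + ?I w z n)" for n
  proof -
    have "?I (\<lambda>n x. v n x + w n x) (\<lambda>x. u x + z x) n
        \<le> (\<integral>x. 2 powr p * (norm (v n x - u x) powr p + norm (w n x - z x) powr p) \<partial>lebesgue_on \<Omega>)"
      using d[of n] by (intro integral_mono le) (simp_all add: in_Lp_def)
    also have "\<dots> = 2 powr p * (?I v u n + ?I w z n)"
      using d[of n] by (simp add: in_Lp_def)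
    finally show ?thesis .
  qed
  note le_I = this
  have "(\<lambda>n. 2 powr p * (?I v u n + ?I w z n)) \<longlonglongrightarrow> 2 powr p * (0 + 0)"
    using assms(2,3)[unfolded Lp_tendsto_iff[OF assms(1)]]
    by (intro tendsto_mult tendsto_add tendsto_const) blast+
  then have lim: "(\<lambda>n. 2 powr p * (?I v u n + ?I w z n)) \<longlonglongrightarrow> 0" by simp
  have "?I (\<lambda>n x. v n x + w n x) (\<lambda>x. u x + z x) \<longlonglongrightarrow> 0"
    by (rule tendsto_sandwich[OF always_eventually always_eventually tendsto_const lim])
       (simp, use le_I in blast)
  with Lp show ?thesis
    by (simp add: Lp_tendsto_iff assms(1) in_Lp_add)
qed

text \<open>The \<open>p\<close>-th powers of the differences are dominated by a multiple of \<open>\<bar>h\<bar>\<^sup>p\<close>.\<close>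

lemma Lp_dominated_convergence:
  assumes "p > 0" "in_Lp p \<Omega> h"
    and "\<And>n. w n \<in> borel_measurable (lebesgue_on \<Omega>)" "z \<in> borel_measurable (lebesgue_on \<Omega>)"
    and bw: "\<And>n x. norm (w n x) \<le> c * norm (h x)" and bz: "\<And>x. norm (z x) \<le> c * norm (h x)"
    and lim: "AE x in lebesgue_on \<Omega>. (\<lambda>n. w n x) \<longlonglongrightarrow> z x"
  shows "Lp_tendsto p \<Omega> w z"
proof -
  have Lp: "in_Lp p \<Omega> (w n)" "in_Lp p \<Omega> z" for n
    by (rule in_Lp_bounded[OF assms(1-3) bw], rule in_Lp_bounded[OF assms(1,2,4) bz])
  have [measurable]: "w n \<in> borel_measurable (lebesgue_on \<Omega>)" "z \<in> borel_measurable (lebesgue_on \<Omega>)" for n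
    by fact+
  have "(\<lambda>n. \<integral>x. norm (w n x - z x) powr p \<partial>lebesgue_on \<Omega>) \<longlonglongrightarrow> (\<integral>x. 0 \<partial>lebesgue_on \<Omega>)"
  proof (rule integral_dominated_convergence
        [where w = "\<lambda>x. (2 * \<bar>c\<bar>) powr p * norm (h x) powr p"])
    show "integrable (lebesgue_on \<Omega>) (\<lambda>x. (2 * \<bar>c\<bar>) powr p * norm (h x) powr p)"
      using assms(2) by (simp add: in_Lp_def)
    show "AE x in lebesgue_on \<Omega>. (\<lambda>n. norm (w n x - z x) powr p) \<longlonglongrightarrow> 0"
      using lim
    proof eventually_elim
      case (elim x)
      then have "(\<lambda>n. norm (w n x - z x)) \<longlonglongrightarrow> 0"
        by (simp add: LIM_zero_iff tendsto_norm_zero_iff)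
      from tendsto_zero_powrI[OF this tendsto_const _ assms(1)] show ?case by simp
    qed
    show "AE x in lebesgue_on \<Omega>. norm (norm (w n x - z x) powr p) \<le> (2 * \<bar>c\<bar>) powr p * norm (h x) powr p" for n
    proof (rule AE_I2)
      fix x
      have "c * norm (h x) \<le> \<bar>c\<bar> * norm (h x)"
        by (intro mult_right_mono) auto
      then have "norm (w n x - z x) \<le> 2 * \<bar>c\<bar> * norm (h x)"
        using norm_triangle_ineq4[of "w n x" "z x"] bw[of n x] bz[of x] by linarith
      then have "norm (w n x - z x) powr p \<le> (2 * \<bar>c\<bar> * norm (h x)) powr p"
        using assms(1) by (intro powr_mono2) auto
      then show "norm (norm (w n x - z x) powr p) \<le> (2 * \<bar>c\<bar>) powr p * norm (h x) powr p"
        by (simp add: powr_mult)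
    qed
  qed auto
  with Lp show ?thesis
    by (simp add: Lp_tendsto_iff assms(1))
qed

text \<open>Serves both limits of the argument, the removal of the regularisation and that of the truncation:
  a bound that is uniform in \<open>n\<close> passes to the limit on the strength of pointwise convergence alone.\<close>

lemma Lp_Fatou:
  assumes "p > 0" and w: "\<And>n. in_Lp p \<Omega> (w n)" and z: "z \<in> borel_measurable (lebesgue_on \<Omega>)"
    and lim: "AE x in lebesgue_on \<Omega>. (\<lambda>n. w n x) \<longlonglongrightarrow> z x"
    and bound: "\<And>n. Lp_norm p \<Omega> (w n) \<le> K"
  shows "in_Lp p \<Omega> z" and "Lp_norm p \<Omega> z \<le> K"
proof -
  have [measurable]: "w n \<in> borel_measurable (lebesgue_on \<Omega>)" "z \<in> borel_measurable (lebesgue_on \<Omega>)" for n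
    using w z by (auto simp: in_Lp_def)
  have "0 \<le> Lp_norm p \<Omega> (w 0)" by (simp add: Lp_norm_def)
  then have "K \<ge> 0" using bound[of 0] by linarith
  have int: "(\<integral>\<^sup>+x. ennreal (norm (w n x) powr p) \<partial>lebesgue_on \<Omega>) \<le> ennreal (K powr p)" for n
  proof -
    have "(\<integral>x. norm (w n x) powr p \<partial>lebesgue_on \<Omega>) = Lp_norm p \<Omega> (w n) powr p"
      by (simp add: Lp_norm_powr assms(1))
    also have "\<dots> \<le> K powr p"
      using bound[of n] assms(1) by (intro powr_mono2) (auto simp: Lp_norm_def)
    finally show ?thesis
      using w[of n] by (subst nn_integral_eq_integral) (auto simp: in_Lp_def intro: ennreal_leI)
  qed
  have "(\<integral>\<^sup>+x. ennreal (norm (z x) powr p) \<partial>lebesgue_on \<Omega>)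
      = (\<integral>\<^sup>+x. liminf (\<lambda>n. ennreal (norm (w n x) powr p)) \<partial>lebesgue_on \<Omega>)"
  proof (rule nn_integral_cong_AE)
    show "AE x in lebesgue_on \<Omega>. ennreal (norm (z x) powr p) = liminf (\<lambda>n. ennreal (norm (w n x) powr p))"
      using lim
    proof eventually_elim
      case (elim x)
      have "(\<lambda>n. ennreal (norm (w n x) powr p)) \<longlonglongrightarrow> ennreal (norm (z x) powr p)"
        using assms(1) by (intro tendsto_ennrealI tendsto_powr' tendsto_norm elim tendsto_const) auto
      then show ?case
        by (intro lim_imp_Liminf[symmetric]) simp_all
    qed
  qed
  also have "\<dots> \<le> liminf (\<lambda>n. \<integral>\<^sup>+x. ennreal (norm (w n x) powr p) \<partial>lebesgue_on \<Omega>)"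
    by (rule nn_integral_liminf) measurable
  also have "\<dots> \<le> liminf (\<lambda>n. ennreal (K powr p))"
    using int by (intro Liminf_mono) auto
  also have "\<dots> = ennreal (K powr p)"
    by (simp add: Liminf_const)
  finally have *: "(\<integral>\<^sup>+x. ennreal (norm (z x) powr p) \<partial>lebesgue_on \<Omega>) \<le> ennreal (K powr p)" .
  then show "in_Lp p \<Omega> z"
    unfolding in_Lp_def by (auto intro!: integrableI_bounded simp: le_less_trans)
  then have "ennreal (\<integral>x. norm (z x) powr p \<partial>lebesgue_on \<Omega>) \<le> ennreal (K powr p)"
    using * by (subst (asm) nn_integral_eq_integral) (auto simp: in_Lp_def)
  then have "(\<integral>x. norm (z x) powr p \<partial>lebesgue_on \<Omega>) \<le> K powr p"
    by simp
  then have "Lp_norm p \<Omega> z \<le> (K powr p) powr (1 / p)"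
    unfolding Lp_norm_def using assms(1) by (intro powr_mono2) auto
  then show "Lp_norm p \<Omega> z \<le> K"
    using assms(1) \<open>K \<ge> 0\<close> by (simp add: powr_powr)
qed

text \<open>Young's inequality for \<open>f\<close> and \<open>g\<close> divided by their norms.\<close>

lemma Lp_Holder:
  fixes f g :: "real ^ 'n \<Rightarrow> real"
  assumes pq: "p > 1" "q > 1" "1 / p + 1 / q = 1" and f: "in_Lp p \<Omega> f" and g: "in_Lp q \<Omega> g"
  shows "integrable (lebesgue_on \<Omega>) (\<lambda>x. f x * g x)"
    and "(\<integral>x. \<bar>f x * g x\<bar> \<partial>lebesgue_on \<Omega>) \<le> Lp_norm p \<Omega> f * Lp_norm q \<Omega> g"
proof -
  have [measurable]: "f \<in> borel_measurable (lebesgue_on \<Omega>)" "g \<in> borel_measurable (lebesgue_on \<Omega>)"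
    using f g by (auto simp: in_Lp_def)
  have int: "integrable (lebesgue_on \<Omega>) (\<lambda>x. \<bar>f x\<bar> powr p)" "integrable (lebesgue_on \<Omega>) (\<lambda>x. \<bar>g x\<bar> powr q)"
    using f g by (auto simp: in_Lp_def)
  show fg: "integrable (lebesgue_on \<Omega>) (\<lambda>x. f x * g x)"
  proof (rule Bochner_Integration.integrable_bound)
    show "integrable (lebesgue_on \<Omega>) (\<lambda>x. \<bar>f x\<bar> powr p / p + \<bar>g x\<bar> powr q / q)"
      using int by auto
    show "AE x in lebesgue_on \<Omega>. norm (f x * g x) \<le> norm (\<bar>f x\<bar> powr p / p + \<bar>g x\<bar> powr q / q)"
      using Youngs_inequality[OF pq] pq
      by (intro AE_I2) (simp add: abs_mult abs_of_nonneg)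
  qed measurable
  define a b where "a = Lp_norm p \<Omega> f" and "b = Lp_norm q \<Omega> g"
  have "a \<ge> 0" "b \<ge> 0" by (auto simp: a_def b_def Lp_norm_def)
  show "(\<integral>x. \<bar>f x * g x\<bar> \<partial>lebesgue_on \<Omega>) \<le> Lp_norm p \<Omega> f * Lp_norm q \<Omega> g"
  proof (cases "a = 0 \<or> b = 0")
    case True
    then have "(\<integral>x. \<bar>f x\<bar> powr p \<partial>lebesgue_on \<Omega>) = 0 \<or> (\<integral>x. \<bar>g x\<bar> powr q \<partial>lebesgue_on \<Omega>) = 0"
      by (auto simp: a_def b_def Lp_norm_def)
    then have "(AE x in lebesgue_on \<Omega>. \<bar>f x\<bar> powr p = 0) \<or> (AE x in lebesgue_on \<Omega>. \<bar>g x\<bar> powr q = 0)"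
      using int by (simp add: integral_nonneg_eq_0_iff_AE)
    then have "AE x in lebesgue_on \<Omega>. \<bar>f x * g x\<bar> = 0"
      by (auto elim: AE_mp)
    then have "(\<integral>x. \<bar>f x * g x\<bar> \<partial>lebesgue_on \<Omega>) = (\<integral>x. 0 \<partial>lebesgue_on \<Omega>)"
      by (intro integral_cong_AE) auto
    with \<open>a \<ge> 0\<close> \<open>b \<ge> 0\<close> show ?thesis by (simp add: a_def b_def)
  next
    case False
    with \<open>a \<ge> 0\<close> \<open>b \<ge> 0\<close> have "a > 0" "b > 0" by auto
    have Young: "\<bar>f x * g x\<bar> \<le> a * b * (\<bar>f x\<bar> powr p / a powr p / p + \<bar>g x\<bar> powr q / b powr q / q)" for x
    proof -
      have "\<bar>f x * g x\<bar> = a * b * ((\<bar>f x\<bar> / a) * (\<bar>g x\<bar> / b))"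
        using \<open>a > 0\<close> \<open>b > 0\<close> by (simp add: abs_mult)
      also have "\<dots> \<le> a * b * ((\<bar>f x\<bar> / a) powr p / p + (\<bar>g x\<bar> / b) powr q / q)"
        using \<open>a > 0\<close> \<open>b > 0\<close> by (intro mult_left_mono Youngs_inequality[OF pq]) simp_all
      finally show ?thesis
        using \<open>a > 0\<close> \<open>b > 0\<close> by (simp add: powr_divide)
    qed
    have "(\<integral>x. \<bar>f x * g x\<bar> \<partial>lebesgue_on \<Omega>)
        \<le> (\<integral>x. a * b * (\<bar>f x\<bar> powr p / a powr p / p + \<bar>g x\<bar> powr q / b powr q / q) \<partial>lebesgue_on \<Omega>)"
      by (rule integral_mono[OF integrable_abs[OF fg] _ Young]) (use int in simp)
    also have "\<dots> = a * b * ((\<integral>x. \<bar>f x\<bar> powr p \<partial>lebesgue_on \<Omega>) / a powr p / p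
        + (\<integral>x. \<bar>g x\<bar> powr q \<partial>lebesgue_on \<Omega>) / b powr q / q)"
      using int by simp
    also have "\<dots> = a * b * (1 / p + 1 / q)"
    proof -
      have "(\<integral>x. \<bar>f x\<bar> powr p \<partial>lebesgue_on \<Omega>) = a powr p" "(\<integral>x. \<bar>g x\<bar> powr q \<partial>lebesgue_on \<Omega>) = b powr q"
        using pq by (simp_all add: a_def b_def Lp_norm_powr)
      then show ?thesis using \<open>a > 0\<close> \<open>b > 0\<close> by simp
    qed
    finally show ?thesis using pq by (simp add: a_def b_def)
  qed
qed

lemma Lp_norm_mono:
  assumes "p > 0" "in_Lp p \<Omega> f" "in_Lp p \<Omega> g" "\<And>x. norm (f x) \<le> norm (g x)"
  shows "Lp_norm p \<Omega> f \<le> Lp_norm p \<Omega> g"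
proof -
  have "(\<integral>x. norm (f x) powr p \<partial>lebesgue_on \<Omega>) \<le> (\<integral>x. norm (g x) powr p \<partial>lebesgue_on \<Omega>)"
    using assms(2,3) by (intro integral_mono powr_mono2 assms(4)) (simp_all add: in_Lp_def less_imp_le[OF assms(1)])
  then show ?thesis
    unfolding Lp_norm_def using assms(1) by (intro powr_mono2) auto
qed

lemma in_Lp_smaller_exponent:
  assumes "\<Omega> \<in> lmeasurable" "0 < r" "r \<le> s" "in_Lp s \<Omega> u"
  shows "in_Lp r \<Omega> u"
proof -
  have [measurable]: "u \<in> borel_measurable (lebesgue_on \<Omega>)"
    using assms by (auto simp: in_Lp_def)
  have le: "y powr r \<le> 1 + y powr s" if "y \<ge> 0" for y :: real
  proof (cases "y \<le> 1")
    case True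
    then have "y powr r \<le> 1" using that assms(2) powr_le1[of r y] by simp
    then show ?thesis by (simp add: add_increasing2)
  next
    case False
    then have "y powr r \<le> y powr s" using assms(3) by (intro powr_mono) auto
    then show ?thesis by simp
  qed
  have "integrable (lebesgue_on \<Omega>) (\<lambda>x. norm (u x) powr r)"
  proof (rule Bochner_Integration.integrable_bound)
    interpret finite_measure "lebesgue_on \<Omega>"
      by (rule finite_measure_lebesgue_on[OF assms(1)])
    show "integrable (lebesgue_on \<Omega>) (\<lambda>x. 1 + norm (u x) powr s)"
      using assms(4) by (auto simp: in_Lp_def)
    show "AE x in lebesgue_on \<Omega>. norm (norm (u x) powr r) \<le> norm (1 + norm (u x) powr s)"
      by (rule AE_I2) (simp add: le abs_of_nonneg)
  qed measurable
  then show ?thesis by (simp add: in_Lp_def)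
qed

section \<open>The chain rule for functions vanishing on the boundary\<close>

text \<open>The chain rule in the closure of the test functions.  Along a subsequence the test functions
  \<open>\<phi>\<^sub>n\<close> converge almost everywhere, and
  \<open>X(\<Phi>(\<phi>\<^sub>n)) - g(u) G = g(\<phi>\<^sub>n) (X\<phi>\<^sub>n - G) + (g(\<phi>\<^sub>n) - g(u)) G\<close>.
  The first term is small because \<open>g\<close> is bounded, the second by dominated convergence.  Since \<open>\<Phi>\<close>
  has to preserve test functions, smoothness of the composition is a hypothesis.\<close>

lemma W0_grad_compose:
  fixes u :: "real ^ 'n \<Rightarrow> real" and X :: "'m::finite \<Rightarrow> real ^ 'n \<Rightarrow> real ^ 'n"
  assumes "p > 0" and uG: "W0_grad p \<Omega> X u G"
    and "\<Phi> 0 = 0" and D: "\<And>t. (\<Phi> has_real_derivative g t) (at t)"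
    and g: "continuous_on UNIV g" "\<And>t. \<bar>g t\<bar> \<le> L"
    and smooth: "\<And>(f :: real ^ 'n \<Rightarrow> real) k. (\<And>k. Ck_on k UNIV f) \<Longrightarrow> Ck_on k UNIV (\<lambda>x. \<Phi> (f x))"
  shows "W0_grad p \<Omega> X (\<lambda>x. \<Phi> (u x)) (\<lambda>x. g (u x) *\<^sub>R G x)"
proof -
  obtain \<phi> where test: "\<And>n. test_fun \<Omega> (\<phi> n)"
    and \<phi>u: "Lp_tendsto p \<Omega> \<phi> u" and \<phi>G: "Lp_tendsto p \<Omega> (\<lambda>n. Xgrad X (\<phi> n)) G"
    using uG by (auto simp: W0_grad_def)
  obtain r :: "nat \<Rightarrow> nat" where r: "strict_mono r"
    and AE_lim: "AE x in lebesgue_on \<Omega>. (\<lambda>n. \<phi> (r n) x) \<longlonglongrightarrow> u x"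
    by (rule Lp_tendsto_AE_subseq[OF assms(1) \<phi>u])
  note \<phi>u = Lp_tendsto_subseq[OF \<phi>u r] and \<phi>G = Lp_tendsto_subseq[OF \<phi>G r]
  let ?M = "lebesgue_on \<Omega>"
  have Lp: "in_Lp p \<Omega> u" "in_Lp p \<Omega> G" "in_Lp p \<Omega> (\<phi> (r n))" "in_Lp p \<Omega> (Xgrad X (\<phi> (r n)))" for n
    using \<phi>u \<phi>G by (auto simp: Lp_tendsto_def)
  have [measurable]: "u \<in> borel_measurable ?M" "G \<in> borel_measurable ?M"
    "\<phi> (r n) \<in> borel_measurable ?M" "Xgrad X (\<phi> (r n)) \<in> borel_measurable ?M" for n
    using Lp(1,2) Lp(3,4)[of n] unfolding in_Lp_def by simp_all
  have "continuous_on UNIV \<Phi>"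
    using D by (blast intro: DERIV_continuous continuous_at_imp_continuous_on)
  then have [measurable]: "\<Phi> \<in> borel_measurable borel" "g \<in> borel_measurable borel"
    using g by (auto intro: borel_measurable_continuous_onI)
  have Lipschitz: "\<bar>\<Phi> s - \<Phi> t\<bar> \<le> L * \<bar>s - t\<bar>" for s t
  proof -
    have "norm (\<Phi> s - \<Phi> t) \<le> L * norm (s - t)"
      by (rule field_differentiable_bound[OF convex_UNIV, where f' = g]) (simp_all add: D g(2))
    then show ?thesis by simp
  qed
  have \<Phi>Lp: "in_Lp p \<Omega> (\<lambda>x. \<Phi> (w x))" if "in_Lp p \<Omega> w" for w :: "real ^ 'n \<Rightarrow> real"
  proof (rule in_Lp_bounded[OF assms(1) that])
    have [measurable]: "w \<in> borel_measurable ?M" using that by (simp add: in_Lp_def)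
    show "(\<lambda>x. \<Phi> (w x)) \<in> borel_measurable ?M" by measurable
    show "norm (\<Phi> (w x)) \<le> L * norm (w x)" for x
      using Lipschitz[of "w x" 0] \<open>\<Phi> 0 = 0\<close> by simp
  qed
  show ?thesis
    unfolding W0_grad_def
  proof (intro exI conjI allI)
    show "test_fun \<Omega> (\<lambda>x. \<Phi> (\<phi> (r n) x))" for n
    proof (rule test_fun_compose[where \<Phi> = \<Phi>, OF test \<open>\<Phi> 0 = 0\<close>])
      show "Ck_on k UNIV (\<lambda>x. \<Phi> (\<phi> (r n) x))" for k
        by (rule smooth) (use test[of "r n"] in \<open>simp add: test_fun_def\<close>)
    qed
    show "Lp_tendsto p \<Omega> (\<lambda>n x. \<Phi> (\<phi> (r n) x)) (\<lambda>x. \<Phi> (u x))"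
      by (rule Lp_tendsto_compare[OF assms(1) \<phi>u \<Phi>Lp[OF Lp(3)] \<Phi>Lp[OF Lp(1)], where c = L])
         (simp add: Lipschitz)
    have "\<phi> (r n) differentiable (at x)" for n x
      using test[of "r n"] unfolding test_fun_def by (metis Ck_on.simps(2) UNIV_I)
    then have "Xgrad X (\<lambda>x. \<Phi> (\<phi> (r n) x)) x = g (\<phi> (r n) x) *\<^sub>R Xgrad X (\<phi> (r n)) x" for n x
      by (rule Xgrad_compose[OF D])
    then have grad: "Xgrad X (\<lambda>x. \<Phi> (\<phi> (r n) x))
        = (\<lambda>x. g (\<phi> (r n) x) *\<^sub>R (Xgrad X (\<phi> (r n)) x - G x) + g (\<phi> (r n) x) *\<^sub>R G x)" for n
      by (auto simp: algebra_simps)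
    have "norm (g t *\<^sub>R y) \<le> L * norm y" for t and y :: "real ^ 'm"
      using g(2)[of t] by (simp add: mult_right_mono)
    note bound = this
    have 1: "Lp_tendsto p \<Omega> (\<lambda>n x. g (\<phi> (r n) x) *\<^sub>R (Xgrad X (\<phi> (r n)) x - G x)) (\<lambda>x. 0)"
    proof (rule Lp_tendsto_compare[OF assms(1) \<phi>G])
      show "in_Lp p \<Omega> (\<lambda>x. g (\<phi> (r n) x) *\<^sub>R (Xgrad X (\<phi> (r n)) x - G x))" for n
        by (rule in_Lp_bounded[OF assms(1) in_Lp_diff[OF assms(1) Lp(4,2)] _ bound]) measurable
      show "in_Lp p \<Omega> (\<lambda>x. 0)" by (simp add: in_Lp_def)
      show "norm (g (\<phi> (r n) x) *\<^sub>R (Xgrad X (\<phi> (r n)) x - G x) - 0)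
          \<le> L * norm (Xgrad X (\<phi> (r n)) x - G x)" for n x
        unfolding diff_0_right by (rule bound)
    qed
    have 2: "Lp_tendsto p \<Omega> (\<lambda>n x. g (\<phi> (r n) x) *\<^sub>R G x) (\<lambda>x. g (u x) *\<^sub>R G x)"
    proof (rule Lp_dominated_convergence[OF assms(1) Lp(2) _ _ bound bound])
      have cont: "isCont g t" for t
        using g(1) by (simp add: continuous_on_eq_continuous_at)
      show "AE x in ?M. (\<lambda>n. g (\<phi> (r n) x) *\<^sub>R G x) \<longlonglongrightarrow> g (u x) *\<^sub>R G x"
        using AE_lim
      proof eventually_elim
        case (elim x)
        show ?case
          by (intro tendsto_scaleR tendsto_const isCont_tendsto_compose[OF cont elim])
      qed
    qed measurable
    from Lp_tendsto_add[OF assms(1) 1 2]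
    show "Lp_tendsto p \<Omega> (\<lambda>n. Xgrad X (\<lambda>x. \<Phi> (\<phi> (r n) x))) (\<lambda>x. g (u x) *\<^sub>R G x)"
      by (simp add: grad)
  qed
qed

lemma W0_grad_soft_power:
  fixes \<epsilon> a :: real
  assumes "p > 0" "W0_grad p \<Omega> X u G" "\<epsilon> > 0" "0 < a" "a < 1" "\<Phi> 0 = 0"
    and D: "\<And>t. (\<Phi> has_real_derivative a * (\<epsilon>\<^sup>2 + t\<^sup>2) powr ((a - 1) / 2)) (at t)"
  shows "W0_grad p \<Omega> X (\<lambda>x. \<Phi> (u x)) (\<lambda>x. (a * (\<epsilon>\<^sup>2 + (u x)\<^sup>2) powr ((a - 1) / 2)) *\<^sub>R G x)"
proof (rule W0_grad_compose[OF assms(1,2,6) D])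
  have pos: "\<epsilon>\<^sup>2 + t\<^sup>2 > 0" for t :: real
    using assms by (simp add: add_pos_nonneg)
  show "continuous_on UNIV (\<lambda>t. a * (\<epsilon>\<^sup>2 + t\<^sup>2) powr ((a - 1) / 2))"
    using pos assms(3) by (intro continuous_intros) (simp add: less_imp_neq[symmetric])
  show "\<bar>a * (\<epsilon>\<^sup>2 + t\<^sup>2) powr ((a - 1) / 2)\<bar> \<le> a * (\<epsilon>\<^sup>2) powr ((a - 1) / 2)" for t
    using assms by (auto simp: abs_mult intro!: powr_mono2')
  show "Ck_on k UNIV (\<lambda>x. \<Phi> (f x))" if "\<And>k. Ck_on k UNIV f" for f k
    by (rule Ck_on_soft_power[OF assms(3) D that])
qed

section \<open>The a priori estimate for weak solutions\<close>

text \<open>Pointwise this is ellipticity multiplied by \<open>w\<close>.  The content is integrability of the right-hand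
  side, without which its integral would be \<open>0\<close> by convention: it follows from the two-sided bound
  on the quadratic form and the boundedness of \<open>w\<close>.\<close>

lemma elliptic_weighted_energy:
  assumes A: "elliptic_coeff \<alpha> \<beta> \<Omega> A" and "\<alpha> > 0"
    and G: "in_Lp 2 \<Omega> G"
    and w: "w \<in> borel_measurable (lebesgue_on \<Omega>)" "\<And>x. 0 \<le> w x" "\<And>x. w x \<le> L"
  shows "\<alpha> * (\<integral>x. w x * (norm (G x))\<^sup>2 \<partial>lebesgue_on \<Omega>)
    \<le> (\<integral>x. (A x *v G x) \<bullet> (w x *\<^sub>R G x) \<partial>lebesgue_on \<Omega>)"
proof -
  let ?M = "lebesgue_on \<Omega>"
  have [measurable]: "A \<in> borel_measurable ?M" "G \<in> borel_measurable ?M" "w \<in> borel_measurable ?M"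
    using A G w by (auto simp: elliptic_coeff_def in_Lp_def)
  have ell: "AE x in ?M. \<alpha> * (norm (G x))\<^sup>2 \<le> (A x *v G x) \<bullet> G x \<and> (A x *v G x) \<bullet> G x \<le> \<beta> * (norm (G x))\<^sup>2"
    using A unfolding elliptic_coeff_def by (auto elim: AE_mp)
  have comp: "(\<lambda>x. A x $ i $ j) \<in> borel_measurable ?M" "(\<lambda>x. G x $ j) \<in> borel_measurable ?M" for i j
    by (rule measurable_compose[where g = "\<lambda>M. M $ i $ j", OF \<open>A \<in> borel_measurable ?M\<close>]
          measurable_compose[where g = "\<lambda>y. y $ j", OF \<open>G \<in> borel_measurable ?M\<close>],
        intro borel_measurable_continuous_onI continuous_intros)+
  have [measurable]: "(\<lambda>x. (A x *v G x) \<bullet> (w x *\<^sub>R G x)) \<in> borel_measurable ?M"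
    unfolding inner_vec_def matrix_vector_mult_def using comp by (auto intro!: borel_measurable_sum borel_measurable_times)
  have G2: "integrable ?M (\<lambda>x. (norm (G x))\<^sup>2)"
    using G by (simp add: in_Lp_def)
  have int_w: "integrable ?M (\<lambda>x. w x * (norm (G x))\<^sup>2)"
  proof (rule Bochner_Integration.integrable_bound[OF integrable_mult_right[OF G2, of L]])
    have "\<bar>w x\<bar> \<le> \<bar>L\<bar>" for x using w(2,3)[of x] by linarith
    then show "AE x in ?M. norm (w x * (norm (G x))\<^sup>2) \<le> norm (L * (norm (G x))\<^sup>2)"
      by (intro AE_I2) (simp add: abs_mult mult_right_mono)
  qed measurable
  have int_A: "integrable ?M (\<lambda>x. (A x *v G x) \<bullet> (w x *\<^sub>R G x))"
  proof (rule Bochner_Integration.integrable_bound[OF integrable_mult_right[OF int_w, of \<beta>]])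
    show "AE x in ?M. norm ((A x *v G x) \<bullet> (w x *\<^sub>R G x)) \<le> norm (\<beta> * (w x * (norm (G x))\<^sup>2))"
      using ell
    proof eventually_elim
      case (elim x)
      have "0 \<le> \<alpha> * (norm (G x))\<^sup>2" using \<open>\<alpha> > 0\<close> by simp
      with elim have "\<bar>(A x *v G x) \<bullet> G x\<bar> \<le> \<bar>\<beta> * (norm (G x))\<^sup>2\<bar>" by linarith
      from mult_left_mono[OF this w(2)[of x]] show ?case
        using w(2)[of x] by (simp add: abs_mult mult.left_commute)
    qed
  qed measurable
  have "(\<integral>x. \<alpha> * (w x * (norm (G x))\<^sup>2) \<partial>?M) \<le> (\<integral>x. (A x *v G x) \<bullet> (w x *\<^sub>R G x) \<partial>?M)"
  proof (rule integral_mono_AE[OF integrable_mult_right[OF int_w] int_A])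
    show "AE x in ?M. \<alpha> * (w x * (norm (G x))\<^sup>2) \<le> (A x *v G x) \<bullet> (w x *\<^sub>R G x)"
      using ell
    proof eventually_elim
      case (elim x)
      then show ?case
        using mult_left_mono[OF conjunct1[OF elim] w(2)[of x]] by (simp add: mult.left_commute)
    qed
  qed
  then show ?thesis by simp
qed

text \<open>Here \<open>r = p\<^sup>*\<^sup>*\<close>, \<open>s = 2\<^sup>*\<close> and \<open>q = p'\<close>.  The exponent \<open>\<gamma>\<close> is determined by the requirement that
  the Sobolev inequality applied to \<open>\<bar>u\<bar>\<^sup>\<gamma>\<close> and the Hoelder inequality applied to \<open>f\<close> and
  \<open>\<bar>u\<bar>\<^sup>2\<^sup>\<gamma>\<^sup>-\<^sup>1\<close> involve the same integral, \<open>\<gamma> s = (2 \<gamma> - 1) q\<close>, and the common value is \<open>r\<close>.  The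
  condition \<open>p > 1\<close> amounts to \<open>2 \<gamma> > 1\<close>, and \<open>p < 2 Q / (Q + 2)\<close> amounts to \<open>\<gamma> < 1\<close>.\<close>

lemma exponent_relations:
  fixes p Q :: real
  assumes "Q > 2" "1 < p" "p < 2 * Q / (Q + 2)"
  defines "r \<equiv> p * Q / (Q - 2 * p)" and "s \<equiv> 2 * Q / (Q - 2)" and "q \<equiv> p / (p - 1)"
  defines "\<gamma> \<equiv> r / s"
  shows "0 < r" "r \<le> s" "2 < s" "1 < q" "1 / p + 1 / q = 1" "1 < 2 * \<gamma>" "\<gamma> < 1"
    "\<gamma> * s = r" "(2 * \<gamma> - 1) * q = r" "2 / s - 1 / q = 1 / r"
proof -
  have p: "p * (Q + 2) < 2 * Q" using assms(1,3) by (simp add: pos_less_divide_eq)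
  have "2 * p * (Q + 2) < Q * (Q + 2)"
  proof -
    have "2 * p * (Q + 2) < 4 * Q" using p by simp
    also have "4 * Q \<le> Q * (Q + 2)" using assms(1) by (simp add: algebra_simps mult_left_mono)
    finally show ?thesis .
  qed
  then have d: "Q - 2 * p > 0" using assms(1) by simp
  have g: "\<gamma> = p * (Q - 2) / (2 * (Q - 2 * p))"
    using assms(1) d by (simp add: \<gamma>_def r_def s_def field_simps)
  show r: "0 < r" using d assms by (simp add: r_def)
  show s: "2 < s" using assms(1) by (simp add: s_def field_simps)
  show "1 < q" using assms(2) by (simp add: q_def)
  show "1 / p + 1 / q = 1" using assms(2) by (simp add: q_def field_simps)
  show "1 < 2 * \<gamma>"
    using d assms(1,2) mult_strict_right_mono[OF assms(2), of Q] unfolding g by (simp add: field_simps)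
  show g1: "\<gamma> < 1"
    using d p unfolding g by (simp add: field_simps)
  show "\<gamma> * s = r" using s by (simp add: \<gamma>_def)
  with g1 s show "r \<le> s" by (metis less_imp_le mult_left_le_one_le mult_less_cancel_right2 linorder_not_less order_less_trans zero_less_numeral)
  show "(2 * \<gamma> - 1) * q = r"
  proof -
    have "2 * \<gamma> - 1 = Q * (p - 1) / (Q - 2 * p)"
      using d unfolding g by (simp add: field_simps)
    then show ?thesis
      using assms(2) by (simp add: q_def r_def)
  qed
  show "2 / s - 1 / q = 1 / r"
    using d assms(1,2) unfolding s_def q_def r_def by (simp add: field_simps)
qed

text \<open>Let \<open>\<Phi>\<close> and \<open>\<Psi>\<close> be the regularised powers with exponents \<open>2 \<gamma> - 1\<close> and \<open>\<gamma>\<close>.  Then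
  \<open>(\<Psi>')\<^sup>2 = \<gamma>\<^sup>2 / (2 \<gamma> - 1) * \<Phi>'\<close>, so the energy \<open>\<integral> \<Phi>'(u) \<bar>Xu\<bar>\<^sup>2\<close>, which testing the equation with
  \<open>\<Phi>(u)\<close> controls by the datum, is up to a constant the square of the \<open>L\<^sup>2\<close> norm of \<open>X(\<Psi>(u))\<close>, to
  which the Sobolev inequality applies.  Bounding \<open>\<Psi>\<close> from below and \<open>\<Phi>\<close> from above by explicit
  functions leaves an inequality whose right-hand side does not depend on \<open>\<epsilon>\<close>.\<close>

lemma weak_solution_soft_power_estimate:
  fixes u h :: "real ^ 'n \<Rightarrow> real" and X :: "'m::finite \<Rightarrow> real ^ 'n \<Rightarrow> real ^ 'n"
  assumes Sob: "\<And>u G. W0_grad 2 \<Omega> X u G \<Longrightarrow> in_Lp s \<Omega> u \<and> Lp_norm s \<Omega> u \<le> S * Lp_norm 2 \<Omega> G"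
    and "s > 0" "\<alpha> > 0" "elliptic_coeff \<alpha> \<beta> \<Omega> A" "weak_solution \<Omega> X A h u"
    and "\<epsilon> > 0" "1 < 2 * \<gamma>" "\<gamma> < 1"
    and pq: "p > 1" "q > 1" "1 / p + 1 / q = 1"
    and h: "in_Lp p \<Omega> h" and u: "in_Lp ((2 * \<gamma> - 1) * q) \<Omega> u"
  defines "w \<equiv> \<lambda>x. (\<epsilon> + \<bar>u x\<bar>) powr \<gamma> - \<epsilon> powr \<gamma>"
  shows "in_Lp s \<Omega> w"
    and "(Lp_norm s \<Omega> w)\<^sup>2 \<le> S\<^sup>2 * \<gamma>\<^sup>2 / (\<alpha> * (2 * \<gamma> - 1)) * Lp_norm p \<Omega> h *
           (\<integral>x. \<bar>u x\<bar> powr ((2 * \<gamma> - 1) * q) \<partial>lebesgue_on \<Omega>) powr (1 / q)"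
proof -
  let ?M = "lebesgue_on \<Omega>" and ?a = "2 * \<gamma> - 1"
  obtain G where uG: "W0_grad 2 \<Omega> X u G"
    and sol: "\<And>v H. W0_grad 2 \<Omega> X v H \<Longrightarrow>
      (\<integral>x. (A x *v G x) \<bullet> H x \<partial>?M) = (\<integral>x. h x * v x \<partial>?M)"
    using assms(5) by (auto simp: weak_solution_def)
  have G: "in_Lp 2 \<Omega> G"
    using uG by (auto simp: W0_grad_def Lp_tendsto_def)
  have [measurable]: "u \<in> borel_measurable ?M" "G \<in> borel_measurable ?M"
    using u G by (auto simp: in_Lp_def)
  have a: "0 < ?a" "?a < 1" and \<gamma>: "0 < \<gamma>"
    using assms(7,8) by auto
  obtain \<Phi> where \<Phi>: "\<Phi> 0 = 0"
    "\<And>t. (\<Phi> has_real_derivative ?a * (\<epsilon>\<^sup>2 + t\<^sup>2) powr ((?a - 1) / 2)) (at t)"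
    using soft_power_primitive[OF \<open>\<epsilon> > 0\<close>, of ?a] by blast
  obtain \<Psi> where \<Psi>: "\<Psi> 0 = 0"
    "\<And>t. (\<Psi> has_real_derivative \<gamma> * (\<epsilon>\<^sup>2 + t\<^sup>2) powr ((\<gamma> - 1) / 2)) (at t)"
    using soft_power_primitive[OF \<open>\<epsilon> > 0\<close>, of \<gamma>] by blast
  define \<rho> where "\<rho> x = ?a * (\<epsilon>\<^sup>2 + (u x)\<^sup>2) powr ((?a - 1) / 2)" for x
  define E where "E = (\<integral>x. \<rho> x * (norm (G x))\<^sup>2 \<partial>?M)"
  define N where "N = (\<integral>x. \<bar>u x\<bar> powr (?a * q) \<partial>?M)"
  have "W0_grad 2 \<Omega> X (\<lambda>x. \<Phi> (u x)) (\<lambda>x. \<rho> x *\<^sub>R G x)"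
    unfolding \<rho>_def by (rule W0_grad_soft_power[OF _ uG \<open>\<epsilon> > 0\<close> a \<Phi>]) simp
  note test = sol[OF this]
  have "\<alpha> * E \<le> (\<integral>x. (A x *v G x) \<bullet> (\<rho> x *\<^sub>R G x) \<partial>?M)"
    unfolding E_def
  proof (rule elliptic_weighted_energy[OF assms(4) \<open>\<alpha> > 0\<close> G])
    show "\<rho> \<in> borel_measurable ?M" unfolding \<rho>_def by measurable
    show "0 \<le> \<rho> x" for x using a by (simp add: \<rho>_def)
    show "\<rho> x \<le> ?a * (\<epsilon>\<^sup>2) powr ((?a - 1) / 2)" for x
      unfolding \<rho>_def using a \<open>\<epsilon> > 0\<close> by (intro mult_left_mono powr_mono2') auto
  qed
  also have "\<dots> = (\<integral>x. h x * \<Phi> (u x) \<partial>?M)" by (rule test)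
  also have "\<dots> \<le> (\<integral>x. \<bar>h x * \<Phi> (u x)\<bar> \<partial>?M)"
    by (rule order_trans[OF abs_ge_self integral_abs_bound])
  also have "\<dots> \<le> Lp_norm p \<Omega> h * N powr (1 / q)"
  proof -
    have "continuous_on UNIV \<Phi>"
      using \<Phi>(2) by (blast intro: DERIV_continuous continuous_at_imp_continuous_on)
    then have [measurable]: "\<Phi> \<in> borel_measurable borel"
      by (rule borel_measurable_continuous_onI)
    have powers: "in_Lp q \<Omega> (\<lambda>x. \<bar>u x\<bar> powr ?a)"
      using u by (simp add: in_Lp_def powr_powr)
    have bound: "norm (\<Phi> (u x)) \<le> norm (\<bar>u x\<bar> powr ?a)" for x
      using soft_power_bounds(2)[OF \<open>\<epsilon> > 0\<close> a \<Phi>, of "u x"] by simp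
    have \<Phi>u: "in_Lp q \<Omega> (\<lambda>x. \<Phi> (u x))"
    proof (rule in_Lp_bounded[OF _ powers])
      show "norm (\<Phi> (u x)) \<le> 1 * norm (\<bar>u x\<bar> powr ?a)" for x
        using bound[of x] by simp
    qed (use pq in simp_all)
    have "Lp_norm q \<Omega> (\<lambda>x. \<Phi> (u x)) \<le> Lp_norm q \<Omega> (\<lambda>x. \<bar>u x\<bar> powr ?a)"
      using pq by (intro Lp_norm_mono \<Phi>u powers bound) simp
    also have "\<dots> = N powr (1 / q)"
      by (simp add: Lp_norm_def N_def powr_powr)
    finally have "Lp_norm p \<Omega> h * Lp_norm q \<Omega> (\<lambda>x. \<Phi> (u x)) \<le> Lp_norm p \<Omega> h * N powr (1 / q)"
      by (intro mult_left_mono) (simp_all add: Lp_norm_def)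
    with Lp_Holder(2)[OF pq h \<Phi>u] show ?thesis by simp
  qed
  finally have energy: "E \<le> Lp_norm p \<Omega> h * N powr (1 / q) / \<alpha>"
    using \<open>\<alpha> > 0\<close> by (simp add: field_simps)

  have \<Psi>u: "W0_grad 2 \<Omega> X (\<lambda>x. \<Psi> (u x)) (\<lambda>x. (\<gamma> * (\<epsilon>\<^sup>2 + (u x)\<^sup>2) powr ((\<gamma> - 1) / 2)) *\<^sub>R G x)"
    by (rule W0_grad_soft_power[OF _ uG \<open>\<epsilon> > 0\<close> \<gamma> \<open>\<gamma> < 1\<close> \<Psi>]) simp
  have \<Psi>s: "in_Lp s \<Omega> (\<lambda>x. \<Psi> (u x))"
    using Sob[OF \<Psi>u] by simp
  \<comment> \<open>Nonnegativity lets the lower bound for \<open>\<bar>\<Psi>\<bar>\<close> be read as a bound for \<open>\<bar>w\<bar>\<close>.\<close>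
  have w0: "0 \<le> w x" for x
    using \<open>\<epsilon> > 0\<close> \<gamma> by (simp add: w_def powr_mono2)
  have bound: "norm (w x) \<le> norm (\<Psi> (u x))" for x
    using soft_power_bounds(1)[OF \<open>\<epsilon> > 0\<close> \<gamma> \<open>\<gamma> < 1\<close> \<Psi>, of "u x"] w0[of x] by (simp add: w_def)
  show w: "in_Lp s \<Omega> w"
  proof (rule in_Lp_bounded[OF \<open>s > 0\<close> \<Psi>s])
    show "norm (w x) \<le> 1 * norm (\<Psi> (u x))" for x using bound[of x] by simp
    show "w \<in> borel_measurable ?M" unfolding w_def by measurable
  qed
  \<comment> \<open>\<open>(\<Psi>')\<^sup>2 = \<gamma>\<^sup>2 / (2 \<gamma> - 1) * \<Phi>'\<close> along \<open>u\<close>\<close>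
  have weight: "norm ((\<gamma> * (\<epsilon>\<^sup>2 + (u x)\<^sup>2) powr ((\<gamma> - 1) / 2)) *\<^sub>R G x) powr 2
      = \<gamma>\<^sup>2 / ?a * (\<rho> x * (norm (G x))\<^sup>2)" for x
  proof -
    have "((\<epsilon>\<^sup>2 + (u x)\<^sup>2) powr ((\<gamma> - 1) / 2))\<^sup>2 = (\<epsilon>\<^sup>2 + (u x)\<^sup>2) powr (\<gamma> - 1)"
      by (simp add: power2_eq_square flip: powr_add)
    moreover have "(?a - 1) / 2 = \<gamma> - 1" by simp
    ultimately show ?thesis
      using a by (simp only: \<rho>_def) (simp add: power_mult_distrib abs_mult)
  qed
  have "Lp_norm s \<Omega> w \<le> Lp_norm s \<Omega> (\<lambda>x. \<Psi> (u x))"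
    by (rule Lp_norm_mono[OF \<open>s > 0\<close> w \<Psi>s bound])
  also have "\<dots> \<le> S * Lp_norm 2 \<Omega> (\<lambda>x. (\<gamma> * (\<epsilon>\<^sup>2 + (u x)\<^sup>2) powr ((\<gamma> - 1) / 2)) *\<^sub>R G x)"
    using Sob[OF \<Psi>u] by simp
  finally have "(Lp_norm s \<Omega> w)\<^sup>2
      \<le> (S * Lp_norm 2 \<Omega> (\<lambda>x. (\<gamma> * (\<epsilon>\<^sup>2 + (u x)\<^sup>2) powr ((\<gamma> - 1) / 2)) *\<^sub>R G x))\<^sup>2"
    by (intro power_mono) (simp_all add: Lp_norm_def)
  also have "\<dots> = S\<^sup>2 * Lp_norm 2 \<Omega> (\<lambda>x. (\<gamma> * (\<epsilon>\<^sup>2 + (u x)\<^sup>2) powr ((\<gamma> - 1) / 2)) *\<^sub>R G x) powr 2"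
    by (simp add: power_mult_distrib Lp_norm_def)
  also have "\<dots> = S\<^sup>2 * (\<gamma>\<^sup>2 / ?a * E)"
    unfolding E_def by (subst Lp_norm_powr, simp, subst weight) simp
  also have "\<dots> \<le> S\<^sup>2 * (\<gamma>\<^sup>2 / ?a * (Lp_norm p \<Omega> h * N powr (1 / q) / \<alpha>))"
    using a energy by (intro mult_left_mono) simp_all
  also have "\<dots> = S\<^sup>2 * \<gamma>\<^sup>2 / (\<alpha> * ?a) * Lp_norm p \<Omega> h * N powr (1 / q)"
    by (simp add: mult_ac)
  finally show "(Lp_norm s \<Omega> w)\<^sup>2 \<le> S\<^sup>2 * \<gamma>\<^sup>2 / (\<alpha> * (2 * \<gamma> - 1)) * Lp_norm p \<Omega> h *
           (\<integral>x. \<bar>u x\<bar> powr ((2 * \<gamma> - 1) * q) \<partial>?M) powr (1 / q)"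
    by (simp only: N_def)
qed

text \<open>Letting \<open>\<epsilon>\<close> tend to zero in the preceding inequality gives \<open>N\<^sup>2\<^sup>/\<^sup>s \<le> K * N\<^sup>1\<^sup>/\<^sup>q\<close> for
  \<open>N = \<integral> \<bar>u\<bar>\<^sup>r\<close>.  Since \<open>r \<le> s\<close> and \<open>\<Omega>\<close> has finite measure, \<open>N\<close> is known to be finite, and unless it
  is zero the factor \<open>N\<^sup>1\<^sup>/\<^sup>q\<close> can be cancelled; what remains is \<open>N\<^sup>1\<^sup>/\<^sup>r \<le> K\<close>.\<close>

lemma weak_solution_Lp_estimate:
  fixes u h :: "real ^ 'n \<Rightarrow> real" and X :: "'m::finite \<Rightarrow> real ^ 'n \<Rightarrow> real ^ 'n"
    and Q p :: real
  assumes "Q > 2" "1 < p" "p < 2 * Q / (Q + 2)" "\<Omega> \<in> lmeasurable"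
  defines "r \<equiv> p * Q / (Q - 2 * p)" and "s \<equiv> 2 * Q / (Q - 2)"
  defines "\<gamma> \<equiv> r / s"
  assumes Sob: "\<And>u G. W0_grad 2 \<Omega> X u G \<Longrightarrow> in_Lp s \<Omega> u \<and> Lp_norm s \<Omega> u \<le> S * Lp_norm 2 \<Omega> G"
    and "\<alpha> > 0" "elliptic_coeff \<alpha> \<beta> \<Omega> A" "weak_solution \<Omega> X A h u" "in_Lp p \<Omega> h"
  shows "in_Lp r \<Omega> u"
    and "Lp_norm r \<Omega> u \<le> S\<^sup>2 * \<gamma>\<^sup>2 / (\<alpha> * (2 * \<gamma> - 1)) * Lp_norm p \<Omega> h"
proof -
  let ?M = "lebesgue_on \<Omega>"
  define q where "q = p / (p - 1)"
  note ex = exponent_relations[OF assms(1-3), folded r_def s_def q_def, folded \<gamma>_def]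
  have s: "s > 0" using ex(3) by simp
  define K where "K = S\<^sup>2 * \<gamma>\<^sup>2 / (\<alpha> * (2 * \<gamma> - 1)) * Lp_norm p \<Omega> h"
  have "K \<ge> 0"
    using ex(6) \<open>\<alpha> > 0\<close> by (simp add: K_def Lp_norm_def)
  define N where "N = (\<integral>x. \<bar>u x\<bar> powr r \<partial>?M)"
  have "N \<ge> 0" by (simp add: N_def)
  have "in_Lp s \<Omega> u"
    using assms(11) Sob by (auto simp: weak_solution_def)
  with assms(4) ex(1,2) show u: "in_Lp r \<Omega> u"
    by (rule in_Lp_smaller_exponent)
  then have [measurable]: "u \<in> borel_measurable ?M" by (simp add: in_Lp_def)
  define w where "w n x = (1 / real (Suc n) + \<bar>u x\<bar>) powr \<gamma> - (1 / real (Suc n)) powr \<gamma>" for n x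
  have w: "in_Lp s \<Omega> (w n)" "(Lp_norm s \<Omega> (w n))\<^sup>2 \<le> K * N powr (1 / q)" for n
    using weak_solution_soft_power_estimate[OF Sob s \<open>\<alpha> > 0\<close> assms(10,11) _ ex(6,7) assms(2) ex(4,5) assms(12),
        where \<epsilon> = "1 / real (Suc n)"] u
    unfolding ex(9) by (simp_all add: w_def[abs_def] K_def N_def)
  have "Lp_norm s \<Omega> (\<lambda>x. \<bar>u x\<bar> powr \<gamma>) \<le> sqrt (K * N powr (1 / q))"
  proof (rule Lp_Fatou(2)[OF s w(1)])
    show "AE x in ?M. (\<lambda>n. w n x) \<longlonglongrightarrow> \<bar>u x\<bar> powr \<gamma>"
    proof (rule AE_I2)
      fix x
      have "(\<lambda>n. w n x) \<longlonglongrightarrow> (0 + \<bar>u x\<bar>) powr \<gamma> - 0 powr \<gamma>"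
        unfolding w_def using ex(6)
        by (intro tendsto_diff tendsto_powr' tendsto_add tendsto_const LIMSEQ_Suc lim_1_over_n) auto
      then show "(\<lambda>n. w n x) \<longlonglongrightarrow> \<bar>u x\<bar> powr \<gamma>" by simp
    qed
    show "Lp_norm s \<Omega> (w n) \<le> sqrt (K * N powr (1 / q))" for n
      using w(2)[of n] by (rule real_le_rsqrt)
  qed measurable
  then have "N powr (1 / s) \<le> sqrt (K * N powr (1 / q))"
    using ex(8) by (simp add: Lp_norm_def powr_powr N_def)
  then have "(N powr (1 / s))\<^sup>2 \<le> (sqrt (K * N powr (1 / q)))\<^sup>2"
    by (rule power_mono) simp
  then have "(N powr (1 / s))\<^sup>2 \<le> K * N powr (1 / q)"
    using \<open>K \<ge> 0\<close> by simp
  moreover have "(N powr (1 / s))\<^sup>2 = N powr (1 / r) * N powr (1 / q)"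
  proof -
    have "2 / s = 1 / r + 1 / q" using ex(10) by simp
    then show ?thesis by (simp add: power2_eq_square flip: powr_add)
  qed
  ultimately have "N powr (1 / r) * N powr (1 / q) \<le> K * N powr (1 / q)" by simp
  then have "N powr (1 / r) \<le> K"
    using \<open>K \<ge> 0\<close> \<open>N \<ge> 0\<close> by (cases "N = 0") (simp_all add: mult_le_cancel_right)
  then show "Lp_norm r \<Omega> u \<le> S\<^sup>2 * \<gamma>\<^sup>2 / (\<alpha> * (2 * \<gamma> - 1)) * Lp_norm p \<Omega> h"
    by (simp add: Lp_norm_def N_def K_def)
qed

section \<open>Solutions found by approximation\<close>

lemma in_Lp_truncation:
  fixes f :: "real ^ 'n \<Rightarrow> real"
  assumes "p > 0" "in_Lp p \<Omega> f"
  shows "in_Lp p \<Omega> (truncation n f)" and "Lp_norm p \<Omega> (truncation n f) \<le> Lp_norm p \<Omega> f"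
proof -
  have le: "norm (truncation n f x) \<le> norm (f x)" for x
    unfolding truncation_def real_norm_def by linarith
  have [measurable]: "f \<in> borel_measurable (lebesgue_on \<Omega>)"
    using assms by (simp add: in_Lp_def)
  have "truncation n f \<in> borel_measurable (lebesgue_on \<Omega>)"
    unfolding truncation_def[abs_def] by measurable
  then show *: "in_Lp p \<Omega> (truncation n f)"
    by (rule in_Lp_bounded[OF assms, where c = 1]) (use le in simp)
  show "Lp_norm p \<Omega> (truncation n f) \<le> Lp_norm p \<Omega> f"
    by (rule Lp_norm_mono[OF assms(1) * assms(2) le])
qed

theorem theorem4p5:
  fixes \<Omega> :: "(real ^ 'n::finite) set"
    and X :: "'m::finite \<Rightarrow> real ^ 'n \<Rightarrow> real ^ 'n"
    and Q p \<alpha> :: real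
  assumes "CARD('n) \<ge> 2"
    and "open \<Omega>" and "bounded \<Omega>"
    and "locally_Lipschitz_fields X"
    and "X_connected X \<Omega>"
    and "X_dist_continuous X \<Omega>"
    and "Q > 2" and "X_doubling Q X \<Omega>"
    and "X_Poincare X \<Omega>"
    and "X_Sobolev Q X \<Omega>"
    and "1 < p" and "p < 2 * Q / (Q + 2)"
    and "\<alpha> > 0"
  shows "\<exists>C>0. \<forall>\<beta> (A :: real ^ 'n \<Rightarrow> real ^ 'm ^ 'm) f u.
           \<alpha> < \<beta> \<longrightarrow> elliptic_coeff \<alpha> \<beta> \<Omega> A \<longrightarrow> in_Lp p \<Omega> f \<longrightarrow> approx_solution Q \<Omega> X A f u \<longrightarrow>
             in_Lp (p * Q / (Q - 2 * p)) \<Omega> u \<and>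
             Lp_norm (p * Q / (Q - 2 * p)) \<Omega> u \<le> C * Lp_norm p \<Omega> f"
proof -
  define r s where "r = p * Q / (Q - 2 * p)" and "s = 2 * Q / (Q - 2)"
  define \<gamma> where "\<gamma> = r / s"
  note ex = exponent_relations[OF assms(7,11,12), folded r_def s_def, folded \<gamma>_def]
  have \<Omega>: "\<Omega> \<in> lmeasurable"
    using assms(2,3) by (intro lmeasurable_open)
  obtain S where Sob: "\<And>u G. W0_grad 2 \<Omega> X u G \<Longrightarrow>
      in_Lp s \<Omega> u \<and> Lp_norm s \<Omega> u \<le> S * Lp_norm 2 \<Omega> G"
    using assms(10) \<open>Q > 2\<close> unfolding X_Sobolev_def s_def by (metis one_le_numeral)
  define C where "C = S\<^sup>2 * \<gamma>\<^sup>2 / (\<alpha> * (2 * \<gamma> - 1))"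
  have "C \<ge> 0" using ex(6) \<open>\<alpha> > 0\<close> by (simp add: C_def)
  have main: "in_Lp r \<Omega> u \<and> Lp_norm r \<Omega> u \<le> (C + 1) * Lp_norm p \<Omega> f"
    if A: "elliptic_coeff \<alpha> \<beta> \<Omega> A" and f: "in_Lp p \<Omega> f" and u: "approx_solution Q \<Omega> X A f u"
    for \<beta> and A :: "real ^ 'n \<Rightarrow> real ^ 'm ^ 'm" and f u
  proof -
    obtain v \<sigma> where v: "\<And>n. weak_solution \<Omega> X A (truncation n f) (v n)"
      and lim: "\<And>s. 1 \<le> s \<Longrightarrow> s < Q / (Q - 2) \<Longrightarrow> Lp_tendsto s \<Omega> (v \<circ> \<sigma>) u"
      using u unfolding approx_solution_def by blast
    have "1 < Q / (Q - 2)" using \<open>Q > 2\<close> by simp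
    then have L1: "Lp_tendsto 1 \<Omega> (v \<circ> \<sigma>) u" by (intro lim) simp_all
    obtain \<tau> :: "nat \<Rightarrow> nat" where AE: "AE x in lebesgue_on \<Omega>. (\<lambda>n. (v \<circ> \<sigma>) (\<tau> n) x) \<longlonglongrightarrow> u x"
      by (rule Lp_tendsto_AE_subseq[OF _ L1]) simp
    have p: "p > 0" using assms(11) by simp
    note est = weak_solution_Lp_estimate[OF assms(7,11,12) \<Omega>, folded r_def s_def, folded \<gamma>_def,
        OF Sob \<open>\<alpha> > 0\<close> A v in_Lp_truncation(1)[OF p f], folded C_def]
    have bound: "Lp_norm r \<Omega> (v n) \<le> C * Lp_norm p \<Omega> f" for n
      using est(2)[of n] mult_left_mono[OF in_Lp_truncation(2)[OF p f, of n] \<open>C \<ge> 0\<close>] by simp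
    have "u \<in> borel_measurable (lebesgue_on \<Omega>)"
      using L1 by (simp add: Lp_tendsto_def in_Lp_def)
    note Fatou = Lp_Fatou[OF ex(1) _ this AE, unfolded o_def, OF est(1) bound]
    have "C * Lp_norm p \<Omega> f \<le> (C + 1) * Lp_norm p \<Omega> f"
      by (intro mult_right_mono) (simp_all add: Lp_norm_def)
    with Fatou show ?thesis by linarith
  qed
  \<comment> \<open>\<open>C\<close> itself vanishes when the Sobolev constant \<open>S\<close> is \<open>0\<close>.\<close>
  show ?thesis
  proof (intro exI conjI)
    show "0 < C + 1" using \<open>C \<ge> 0\<close> by simp
  qed (use main in \<open>unfold r_def, blast\<close>)
qed

end
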